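(* Assume that $\sigma^2:=\mathbf{Var}(X^{(0)})<\infty$ and that the right tail of the distribution function of $X^{(0)}$ is regularly varying with index $r>2$, that is, $\mathbf{P}(X^{(0)}>u)=u^{-r}L(u)$, where $L$ is slowly varying at infinity. If $$\liminf_{a\to0}\frac{x_a}{a^{-1}\log a^{-1}}>e^r\,\frac{r-2}{2}\,\sigma^2,$$ then $$\mathbf{P}(M^{(a)}>x_a)\sim\frac{x_a^{-r+1}L(x_a)}{(r-1)a}\quad\text{as }a\to0.$$
   Context: $X^{(0)}$ is a real random variable with $\mathbf{E}[X^{(0)}]=0$, and for $a>0$, $X^{(a)}:=X^{(0)}-a$, so $\mathbf{E}[X^{(a)}]=-a$. For each $a>0$, $S^{(a)}_n$ ($n\ge0$, $S^{(a)}_0=0$) is the random walk whose increments are independent copies of $X^{(a)}$, and $M^{(a)}:=\max_{n\ge0}S^{(a)}_n$. $(x_a)_{a>0}$ is a family of positive numbers; $a\to0$ means $a\downarrow0$; $f(a)\sim h(a)$ means $f(a)/h(a)\to1$. *)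

theory Defs
  imports "HOL-Probability.Probability" "HOL-Library.Landau_Symbols"
begin

definition slowly_varying :: "(real \<Rightarrow> real) \<Rightarrow> bool" where
  "slowly_varying L \<longleftrightarrow>
     (\<exists>A. L \<in> borel_measurable (restrict_space borel {A..}) \<and> (\<forall>u\<ge>A. 0 < L u)) \<and>
     (\<forall>c>0. ((\<lambda>u. L (c * u) / L u) \<longlongrightarrow> 1) at_top)"

(* The (n+1)-st increment of the walk is Y n. *)
definition random_walk :: "(nat \<Rightarrow> 'b \<Rightarrow> real) \<Rightarrow> nat \<Rightarrow> 'b \<Rightarrow> real" where
  "random_walk Y n \<omega> = (\<Sum>i<n. Y i \<omega>)"

(* The maximum is attained only almost surely (for negative drift). As a supremum in the
   extended reals it is defined on the whole space and agrees with it where it is attained. *)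
definition walk_max :: "(nat \<Rightarrow> 'b \<Rightarrow> real) \<Rightarrow> 'b \<Rightarrow> ereal" where
  "walk_max Y \<omega> = (SUP n. ereal (random_walk Y n \<omega>))"

definition indep_copies ::
  "'b measure \<Rightarrow> (nat \<Rightarrow> 'b \<Rightarrow> real) \<Rightarrow> 'a measure \<Rightarrow> ('a \<Rightarrow> real) \<Rightarrow> bool" where
  "indep_copies P Y \<Omega> Z \<longleftrightarrow>
     prob_space.indep_vars P (\<lambda>_. borel) Y UNIV \<and>
     (\<forall>n. distr P borel (Y n) = distr \<Omega> borel Z)"

end

theory Submission
  imports Defs "HOL-Real_Asymp.Real_Asymp"
begin

text \<open>Write \<open>V u = P(X > u)\<close> and let \<open>S\<close> be the centred walk, so that the maximum of the drifted
  walk exceeds \<open>x\<close> iff \<open>S\<^sub>k > x + a k\<close> for some \<open>k\<close>. A single big jump is responsible: it has to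
  bring the walk above the line, which at time \<open>n\<close> costs \<open>V (x + a n)\<close>, and the sum of these is about
  \<open>1/a\<close> times the integral of \<open>V\<close> over \<open>[x, \<infinity>)\<close>, evaluated by Karamata's theorem. A quadratic
  supermartingale shows that \<open>S\<close> ever leaves the cone \<open>\<bar>S\<^sub>k\<bar> < \<delta> (x + a k)\<close> with probability at most
  \<open>\<sigma>\<^sup>2 / (\<delta>\<^sup>2 a x)\<close>, which tends to \<open>0\<close>; this gives the lower bound and, after removal of one medium
  jump, controls the paths that use a jump between \<open>\<theta> (x + a n)\<close> and \<open>(1 - \<delta>) (x + a n)\<close>.

  The paths without any jump above \<open>\<theta> (x + a n)\<close> are split dyadically according to the height \<open>w\<close>
  of the line. Half of the drift is spent on reaching height \<open>w\<close>, and the other half compensates an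
  exponential tilt of the truncated increments by \<open>h = ln (a w\<^sup>q) / w\<close> with
  \<open>q = r - 1 + (r - 2)/20\<close>, so that level \<open>w\<close> contributes at most \<open>1 / (a w\<^sup>q)\<close>.
  The tilt is admissible if \<open>h\<close> is below \<open>a / (e \<sigma>\<^sup>2)\<close> with a margin, that is, if \<open>a w / ln (1/a)\<close>
  exceeds \<open>e (r - 2) \<sigma>\<^sup>2\<close> with a margin; as \<open>e\<^sup>r / 2 > 5 e / 4\<close> for \<open>r > 2\<close>, the hypothesis
  on \<open>x\<close> provides this.\<close>

section \<open>Supermartingale inequalities\<close>

context prob_space
begin

text \<open>Fubini for the joint law, which independence makes a product. The inner integral runs
  over a second sample point of the same space, so a fresh increment is averaged while the past
  stays frozen.\<close>

lemma nn_integral_indep_var: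
  assumes ind: "indep_var S U T W" and f[measurable]: "f \<in> borel_measurable (S \<Otimes>\<^sub>M T)"
  shows "(\<integral>\<^sup>+\<omega>. f (U \<omega>, W \<omega>) \<partial>M) = (\<integral>\<^sup>+\<omega>. \<integral>\<^sup>+\<omega>'. f (U \<omega>, W \<omega>') \<partial>M \<partial>M)"
proof -
  have U[measurable]: "random_variable S U" and W[measurable]: "random_variable T W"
    and eq: "distr M S U \<Otimes>\<^sub>M distr M T W = distr M (S \<Otimes>\<^sub>M T) (\<lambda>x. (U x, W x))"
    using ind indep_var_distribution_eq[of S U T W] by simp_all
  interpret W: prob_space "distr M T W" by (rule prob_space_distr) fact
  have "(\<integral>\<^sup>+\<omega>. f (U \<omega>, W \<omega>) \<partial>M) = (\<integral>\<^sup>+p. f p \<partial>(distr M S U \<Otimes>\<^sub>M distr M T W))"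
    unfolding eq by (subst nn_integral_distr) auto
  also have "\<dots> = (\<integral>\<^sup>+u. \<integral>\<^sup>+w. f (u, w) \<partial>distr M T W \<partial>distr M S U)"
    by (subst W.nn_integral_fst[symmetric]) auto
  also have "\<dots> = (\<integral>\<^sup>+\<omega>. \<integral>\<^sup>+w. f (U \<omega>, w) \<partial>distr M T W \<partial>M)"
    by (subst nn_integral_distr) auto
  also have "\<dots> = (\<integral>\<^sup>+\<omega>. \<integral>\<^sup>+\<omega>'. f (U \<omega>, W \<omega>') \<partial>M \<partial>M)"
    by (intro nn_integral_cong) (subst nn_integral_distr, auto)
  finally show ?thesis .
qed

text \<open>\<open>A\<close> will be \<open>{..<n}\<close>, the past of step \<open>n\<close>, or
  \<open>- {i}\<close>, everything but one distinguished jump.\<close>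

lemma indep_var_history:
  assumes "indep_vars (\<lambda>_. borel) \<xi> UNIV" "i \<notin> A"
  shows "indep_var (PiM A (\<lambda>_. borel)) (\<lambda>\<omega>. restrict (\<lambda>j. \<xi> j \<omega>) A)
     (PiM {i} (\<lambda>_. borel)) (\<lambda>\<omega>. restrict (\<lambda>j. \<xi> j \<omega>) {i})"
  by (rule indep_var_restrict[OF assms(1), of A "{i}"]) (use assms(2) in auto)

lemma random_walk_measurable[measurable (raw)]:
  assumes "indep_vars (\<lambda>_. borel) \<xi> UNIV"
  shows "random_walk \<xi> n \<in> borel_measurable M"
proof -
  have [measurable]: "\<xi> i \<in> borel_measurable M" for i using assms by (auto simp: indep_vars_def)
  show ?thesis unfolding random_walk_def by measurable
qed

text \<open>Optional stopping by induction on the horizon: the first summand is the mass of the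
  paths already stopped at level 1, the second the expectation carried by the paths still running. A
  further step only moves mass from the second to the first, and by \<open>super\<close> nothing is
  gained on the way.\<close>

lemma ville_finite:
  fixes g :: "nat \<Rightarrow> real \<Rightarrow> ennreal"
  assumes ind: "indep_vars (\<lambda>_. borel) \<xi> UNIV"
    and g[measurable]: "\<And>n. g n \<in> borel_measurable borel"
    and super: "\<And>n s. (\<integral>\<^sup>+\<omega>. g (Suc n) (s + \<xi> n \<omega>) \<partial>M) \<le> g n s"
  shows "emeasure M {\<omega>\<in>space M. \<exists>k\<le>n. g k (random_walk \<xi> k \<omega>) \<ge> 1} +
     (\<integral>\<^sup>+\<omega>. g n (random_walk \<xi> n \<omega>) * indicator {\<omega>\<in>space M. \<forall>k\<le>n. g k (random_walk \<xi> k \<omega>) < 1} \<omega> \<partial>M) \<le> g 0 0"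
proof -
  note [measurable] = random_walk_measurable[OF ind]
  have \<xi>[measurable]: "\<xi> i \<in> borel_measurable M" for i using ind by (auto simp: indep_vars_def)
  show ?thesis
  proof (induction n)
    case 0
    show ?case
    proof (cases "g 0 0 \<ge> 1")
      case True
      then have "\<not> g 0 0 < 1" by (simp add: not_less)
      then show ?thesis using True by (simp add: random_walk_def emeasure_space_1)
    next
      case False
      then have "g 0 0 < 1" by (simp add: not_le)
      then show ?thesis using False by (simp add: random_walk_def emeasure_space_1)
    qed
  next
    case (Suc n)
    let ?W = "random_walk \<xi>"
    let ?D = "\<lambda>n. {\<omega>\<in>space M. \<forall>k\<le>n. g k (?W k \<omega>) < 1}"
    let ?E = "{\<omega>\<in>?D n. g (Suc n) (?W (Suc n) \<omega>) \<ge> 1}"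
    let ?T = "\<lambda>n. {\<omega>\<in>space M. \<exists>k\<le>n. g k (?W k \<omega>) \<ge> 1}"
    let ?B = "PiM {..<n} (\<lambda>_. borel) :: (nat \<Rightarrow> real) measure"
    \<comment> \<open>The walk, its survival up to time \<open>n\<close> and the integrand are
      recast as functions of the coordinates up to \<open>n\<close>, the form that
      \<open>nn_integral_indep_var\<close> asks for.\<close>
    define w :: "nat \<Rightarrow> (nat \<Rightarrow> real) \<Rightarrow> real" where "w k u = (\<Sum>i<k. u i)" for k u
    have w[measurable]: "k \<le> n \<Longrightarrow> w k \<in> borel_measurable ?B" for k
      unfolding w_def by (intro borel_measurable_sum measurable_component_singleton) auto
    define I where "I u = (indicator {u. \<forall>k\<le>n. g k (w k u) < 1} u :: ennreal)" for u
    have I[measurable]: "I \<in> borel_measurable ?B"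
    proof -
      have "{u \<in> space ?B. \<forall>k\<le>n. g k (w k u) < 1} \<in> sets ?B"
      proof -
        have "{u \<in> space ?B. \<forall>k\<in>{..n}. g k (w k u) < 1} \<in> sets ?B"
          by (intro sets.sets_Collect_finite_All) (auto intro!: borel_measurable_less measurable_compose[OF w g])
        then show ?thesis by (simp add: Ball_def)
      qed
      then have "(indicator {u \<in> space ?B. \<forall>k\<le>n. g k (w k u) < 1} :: _ \<Rightarrow> ennreal) \<in> borel_measurable ?B"
        by simp
      then show ?thesis
        by (rule measurable_cong[THEN iffD1, rotated]) (auto simp: I_def indicator_def)
    qed
    let ?U = "\<lambda>\<omega>. restrict (\<lambda>i. \<xi> i \<omega>) {..<n}" and ?V = "\<lambda>\<omega>. restrict (\<lambda>i. \<xi> i \<omega>) {n}"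
    have wU: "w k (?U \<omega>) = ?W k \<omega>" if "k \<le> n" for k \<omega>
      using that by (auto simp: w_def random_walk_def intro!: sum.cong)
    have IU: "I (?U \<omega>) = indicator (?D n) \<omega>" if "\<omega> \<in> space M" for \<omega>
      using that by (auto simp: I_def wU indicator_def)
    define f where "f p = g (Suc n) (w n (fst p) + snd p n) * I (fst p)" for p
    have f[measurable]: "f \<in> borel_measurable (?B \<Otimes>\<^sub>M PiM {n} (\<lambda>_. borel))"
      unfolding f_def by measurable
    have "?T (Suc n) \<subseteq> ?T n \<union> ?E"
      by (auto simp: le_Suc_eq)
    then have "emeasure M (?T (Suc n)) \<le> emeasure M (?T n \<union> ?E)"
      by (intro emeasure_mono) auto
    also have "\<dots> \<le> emeasure M (?T n) + emeasure M ?E"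
      by (intro emeasure_subadditive) auto
    finally have 1: "emeasure M (?T (Suc n)) \<le> emeasure M (?T n) + emeasure M ?E" .
    \<comment> \<open>On the newly stopped paths \<open>?E\<close> the indicator is at most
      \<open>g (Suc n)\<close>, so the stopped and the surviving part together fit into the integral
      of \<open>g (Suc n)\<close> over \<open>?D n\<close>.\<close>
    have "emeasure M ?E + (\<integral>\<^sup>+\<omega>. g (Suc n) (?W (Suc n) \<omega>) * indicator (?D (Suc n)) \<omega> \<partial>M)
       = (\<integral>\<^sup>+\<omega>. indicator ?E \<omega> + g (Suc n) (?W (Suc n) \<omega>) * indicator (?D (Suc n)) \<omega> \<partial>M)"
      by (subst nn_integral_add) auto
    also have "\<dots> \<le> (\<integral>\<^sup>+\<omega>. g (Suc n) (?W (Suc n) \<omega>) * indicator (?D n) \<omega> \<partial>M)"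
      by (intro nn_integral_mono) (auto simp: indicator_def le_Suc_eq)
    also have "\<dots> = (\<integral>\<^sup>+\<omega>. f (?U \<omega>, ?V \<omega>) \<partial>M)"
      by (intro nn_integral_cong) (auto simp: f_def IU wU random_walk_def)
    also have "\<dots> = (\<integral>\<^sup>+\<omega>. \<integral>\<^sup>+\<omega>'. f (?U \<omega>, ?V \<omega>') \<partial>M \<partial>M)"
      by (rule nn_integral_indep_var[OF indep_var_history[OF ind]]) auto
    also have "\<dots> \<le> (\<integral>\<^sup>+\<omega>. g n (?W n \<omega>) * indicator (?D n) \<omega> \<partial>M)"
    proof (intro nn_integral_mono)
      fix \<omega> assume "\<omega> \<in> space M"
      have "(\<integral>\<^sup>+\<omega>'. f (?U \<omega>, ?V \<omega>') \<partial>M) = (\<integral>\<^sup>+\<omega>'. g (Suc n) (?W n \<omega> + \<xi> n \<omega>') * I (?U \<omega>) \<partial>M)"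
        unfolding f_def by (simp add: wU)
      also have "\<dots> = (\<integral>\<^sup>+\<omega>'. g (Suc n) (?W n \<omega> + \<xi> n \<omega>') \<partial>M) * I (?U \<omega>)"
        by (rule nn_integral_multc) auto
      also have "\<dots> \<le> g n (?W n \<omega>) * I (?U \<omega>)"
        by (intro mult_right_mono super) auto
      finally show "(\<integral>\<^sup>+\<omega>'. f (?U \<omega>, ?V \<omega>') \<partial>M) \<le> g n (?W n \<omega>) * indicator (?D n) \<omega>"
        using IU[OF \<open>\<omega> \<in> space M\<close>] by simp
    qed
    finally have 2: "emeasure M ?E + (\<integral>\<^sup>+\<omega>. g (Suc n) (?W (Suc n) \<omega>) * indicator (?D (Suc n)) \<omega> \<partial>M)
      \<le> (\<integral>\<^sup>+\<omega>. g n (?W n \<omega>) * indicator (?D n) \<omega> \<partial>M)" .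
    note add_right_mono[OF 1, of "\<integral>\<^sup>+\<omega>. g (Suc n) (?W (Suc n) \<omega>) * indicator (?D (Suc n)) \<omega> \<partial>M"]
    also note add.assoc
    also note add_left_mono[OF 2, of "emeasure M (?T n)"]
    finally have "emeasure M (?T (Suc n)) + (\<integral>\<^sup>+\<omega>. g (Suc n) (?W (Suc n) \<omega>) * indicator (?D (Suc n)) \<omega> \<partial>M)
      \<le> emeasure M (?T n) + (\<integral>\<^sup>+\<omega>. g n (?W n \<omega>) * indicator (?D n) \<omega> \<partial>M)"
      .
    also have "\<dots> \<le> g 0 0" by (rule Suc)
    finally show ?case .
  qed
qed

text \<open>Continuity from below in the horizon, after dropping the contribution of the surviving
  paths.\<close>

lemma ville:
  fixes g :: "nat \<Rightarrow> real \<Rightarrow> ennreal"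
  assumes ind: "indep_vars (\<lambda>_. borel) \<xi> UNIV"
    and g[measurable]: "\<And>n. g n \<in> borel_measurable borel"
    and super: "\<And>n s. (\<integral>\<^sup>+\<omega>. g (Suc n) (s + \<xi> n \<omega>) \<partial>M) \<le> g n s"
  shows "emeasure M {\<omega>\<in>space M. \<exists>k. g k (random_walk \<xi> k \<omega>) \<ge> 1} \<le> g 0 0"
proof -
  note [measurable] = random_walk_measurable[OF ind]
  let ?T = "\<lambda>n. {\<omega>\<in>space M. \<exists>k\<le>n. g k (random_walk \<xi> k \<omega>) \<ge> 1}"
  have "{\<omega>\<in>space M. \<exists>k. g k (random_walk \<xi> k \<omega>) \<ge> 1} = (\<Union>n. ?T n)" by auto
  also have "emeasure M (\<Union>n. ?T n) = (SUP n. emeasure M (?T n))"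
    by (intro SUP_emeasure_incseq[symmetric]) (auto simp: incseq_def intro: order_trans)
  also have "\<dots> \<le> g 0 0"
  proof (rule SUP_least)
    show "emeasure M (?T n) \<le> g 0 0" for n
      using ville_finite[where \<xi>=\<xi> and g=g and n=n, OF ind g super] by (rule order_trans[rotated]) simp
  qed
  finally show ?thesis .
qed

text \<open>Ville's inequality for a process quadratic in the walk; the cross term of a step
  vanishes because the increments are centred. Second moments are only bounded by \<open>v\<close>,
  so that one increment can later be replaced by 0.\<close>

lemma walk_crosses_line:
  assumes ind: "indep_vars (\<lambda>_. borel) \<xi> UNIV"
    and int: "\<And>n. integrable M (\<xi> n)" "\<And>n. integrable M (\<lambda>\<omega>. (\<xi> n \<omega>)\<^sup>2)"
    and mean: "\<And>n. expectation (\<xi> n) = 0"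
    and var: "\<And>n. expectation (\<lambda>\<omega>. (\<xi> n \<omega>)\<^sup>2) \<le> v"
    and t: "t > 0" and b: "b > 0"
  shows "prob {\<omega>\<in>space M. \<exists>k. \<bar>random_walk \<xi> k \<omega>\<bar> \<ge> t + b * real k} \<le> v / (b * t)"
proof -
  define T where "T n = t + b * real n" for n :: nat
  have T: "T n > 0" for n using t b by (simp add: T_def add_pos_nonneg)
  have v: "v \<ge> 0" by (rule order_trans[OF _ var[of 0]]) (rule Bochner_Integration.integral_nonneg, simp)
  \<comment> \<open>One step adds at most \<open>v / (T (n + 1))\<^sup>2\<close> to the first summand; the second one, whose
    increments telescope, decreases by at least as much.\<close>
  define g where "g n s = s\<^sup>2 / (T n)\<^sup>2 + v / (b * T n)" for n s
  have g0: "g n s \<ge> 0" for n s unfolding g_def using T[of n] v b by simp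
  have super: "(\<integral>\<^sup>+\<omega>. ennreal (g (Suc n) (s + \<xi> n \<omega>)) \<partial>M) \<le> ennreal (g n s)" for n s
  proof -
    have gi: "g (Suc n) (s + \<xi> n \<omega>) = (s\<^sup>2 / (T (Suc n))\<^sup>2 + v / (b * T (Suc n))) + 2 * s / (T (Suc n))\<^sup>2 * \<xi> n \<omega>
        + 1 / (T (Suc n))\<^sup>2 * (\<xi> n \<omega>)\<^sup>2" for \<omega>
      unfolding g_def power2_sum by (simp add: add_divide_distrib algebra_simps)
    have i: "integrable M (\<lambda>\<omega>. g (Suc n) (s + \<xi> n \<omega>))"
      unfolding gi using int by auto
    have "(\<integral>\<^sup>+\<omega>. ennreal (g (Suc n) (s + \<xi> n \<omega>)) \<partial>M) = ennreal (expectation (\<lambda>\<omega>. g (Suc n) (s + \<xi> n \<omega>)))"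
      by (intro nn_integral_eq_integral i) (simp add: g0)
    also have "expectation (\<lambda>\<omega>. g (Suc n) (s + \<xi> n \<omega>)) =
       (s\<^sup>2 / (T (Suc n))\<^sup>2 + v / (b * T (Suc n))) + 1 / (T (Suc n))\<^sup>2 * expectation (\<lambda>\<omega>. (\<xi> n \<omega>)\<^sup>2)"
      unfolding gi using int mean by (simp add: prob_space)
    also have "\<dots> \<le> (s\<^sup>2 / (T (Suc n))\<^sup>2 + v / (b * T (Suc n))) + 1 / (T (Suc n))\<^sup>2 * v"
      by (intro add_left_mono mult_left_mono var) auto
    also have "\<dots> \<le> g n s"
    proof -
      have TS: "T (Suc n) = T n + b" by (simp add: T_def algebra_simps)
      have "s\<^sup>2 / (T (Suc n))\<^sup>2 \<le> s\<^sup>2 / (T n)\<^sup>2"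
        using T[of n] T[of "Suc n"] b by (intro divide_left_mono power_mono mult_pos_pos) (auto simp: TS)
      moreover have "v / (b * T (Suc n)) + 1 / (T (Suc n))\<^sup>2 * v \<le> v / (b * T n)"
      proof -
        have "1 / (T (Suc n))\<^sup>2 \<le> 1 / (T n * T (Suc n))"
          unfolding power2_eq_square
          using T[of n] T[of "Suc n"] b by (intro divide_left_mono mult_right_mono mult_pos_pos) (auto simp: TS)
        then have "v * (1 / (T (Suc n))\<^sup>2) \<le> v * (1 / (T n * T (Suc n)))"
          using v by (rule mult_left_mono)
        moreover have "v / (b * T n) - v / (b * T (Suc n)) = v * (1 / (T n * T (Suc n)))"
          using T[of n] b add_pos_pos[OF T[of n] b] unfolding TS
          by (simp add: divide_simps) (simp add: algebra_simps)
        ultimately show ?thesis by (simp add: mult.commute)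
      qed
      ultimately show ?thesis unfolding g_def by linarith
    qed
    finally show ?thesis by (simp add: ennreal_leI)
  qed
  have "emeasure M {\<omega>\<in>space M. \<exists>k. ennreal (g k (random_walk \<xi> k \<omega>)) \<ge> 1} \<le> ennreal (g 0 0)"
    by (rule ville[OF ind _ super]) (simp add: g_def)
  moreover have "g 0 0 = v / (b * t)" by (simp add: g_def T_def)
  moreover have "emeasure M {\<omega>\<in>space M. \<exists>k. \<bar>random_walk \<xi> k \<omega>\<bar> \<ge> t + b * real k}
     \<le> emeasure M {\<omega>\<in>space M. \<exists>k. ennreal (g k (random_walk \<xi> k \<omega>)) \<ge> 1}"
  proof (rule emeasure_mono)
    note [measurable] = random_walk_measurable[OF ind]
    show "{\<omega>\<in>space M. \<exists>k. ennreal (g k (random_walk \<xi> k \<omega>)) \<ge> 1} \<in> events"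
      unfolding g_def by measurable
    have "1 \<le> g k s" if "\<bar>s\<bar> \<ge> T k" for k s
    proof -
      have "(T k)\<^sup>2 \<le> s\<^sup>2" using that T[of k] by (simp add: abs_le_square_iff[symmetric])
      then have "1 \<le> s\<^sup>2 / (T k)\<^sup>2" using T[of k] by simp
      then show ?thesis unfolding g_def using T[of k] v b by (simp add: add_increasing2)
    qed
    then show "{\<omega>\<in>space M. \<exists>k. \<bar>random_walk \<xi> k \<omega>\<bar> \<ge> t + b * real k}
       \<subseteq> {\<omega>\<in>space M. \<exists>k. ennreal (g k (random_walk \<xi> k \<omega>)) \<ge> 1}"
      unfolding T_def by auto
  qed
  ultimately have "emeasure M {\<omega>\<in>space M. \<exists>k. \<bar>random_walk \<xi> k \<omega>\<bar> \<ge> t + b * real k} \<le> ennreal (v / (b * t))"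
    by simp
  then show ?thesis
    using v b t by (simp add: emeasure_eq_measure)
qed

text \<open>Chernoff bound along a line: by \<open>mgf\<close> the slope \<open>b\<close> pays in
  each step for the tilt by \<open>h\<close>, so \<open>exp (h * (s - b * real n - w))\<close>, with
  the walk for \<open>s\<close>, is a supermartingale that is at least 1 at a crossing.\<close>

lemma exp_walk_crosses_line:
  assumes ind: "indep_vars (\<lambda>_. borel) \<xi> UNIV"
    and mgf: "\<And>n. (\<integral>\<^sup>+\<omega>. ennreal (exp (h * \<xi> n \<omega>)) \<partial>M) \<le> ennreal (exp (h * b))"
    and h: "h > 0"
  shows "emeasure M {\<omega>\<in>space M. \<exists>k. random_walk \<xi> k \<omega> \<ge> w + b * real k} \<le> ennreal (exp (- (h * w)))"
proof -
  have \<xi>[measurable]: "\<xi> i \<in> borel_measurable M" for i using ind by (auto simp: indep_vars_def)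
  define g where "g n s = exp (h * (s - b * real n - w))" for n :: nat and s
  have "(\<integral>\<^sup>+\<omega>. ennreal (g (Suc n) (s + \<xi> n \<omega>)) \<partial>M) \<le> ennreal (g n s)" for n s
  proof -
    have e: "ennreal (g (Suc n) (s + \<xi> n \<omega>)) = ennreal (exp (h * (s - b * real n - b - w))) * ennreal (exp (h * \<xi> n \<omega>))" for \<omega>
      unfolding g_def by (simp add: ennreal_mult'[symmetric] exp_add[symmetric] algebra_simps)
    have "(\<integral>\<^sup>+\<omega>. ennreal (g (Suc n) (s + \<xi> n \<omega>)) \<partial>M)
        = ennreal (exp (h * (s - b * real n - b - w))) * (\<integral>\<^sup>+\<omega>. ennreal (exp (h * \<xi> n \<omega>)) \<partial>M)"
      unfolding e by (rule nn_integral_cmult) auto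
    also have "\<dots> \<le> ennreal (exp (h * (s - b * real n - b - w))) * ennreal (exp (h * b))"
      by (intro mult_left_mono mgf) auto
    also have "\<dots> = ennreal (g n s)"
      unfolding g_def by (simp add: ennreal_mult'[symmetric] exp_add[symmetric] algebra_simps)
    finally show ?thesis .
  qed
  then have "emeasure M {\<omega>\<in>space M. \<exists>k. ennreal (g k (random_walk \<xi> k \<omega>)) \<ge> 1} \<le> ennreal (g 0 0)"
    by (intro ville[OF ind]) (auto simp: g_def)
  also have "{\<omega>\<in>space M. \<exists>k. ennreal (g k (random_walk \<xi> k \<omega>)) \<ge> 1} = {\<omega>\<in>space M. \<exists>k. random_walk \<xi> k \<omega> \<ge> w + b * real k}"
    using h by (auto simp: g_def zero_le_mult_iff le_diff_eq add_ac)
  finally show ?thesis by (simp add: g_def)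
qed

end

section \<open>Line crossing of a centred walk\<close>

lemma dyadic_bracket:
  fixes s :: real
  assumes "1 \<le> s"
  obtains k :: nat where "2 ^ k \<le> s" "s < 2 ^ Suc k"
proof -
  obtain n :: nat where n: "s < 2 ^ n" using real_arch_pow[of 2 s] by auto
  define m where "m = (LEAST n. s < 2 ^ n)"
  have m: "s < 2 ^ m" unfolding m_def by (rule LeastI[of _ n]) (rule n)
  have "m \<noteq> 0" using m assms by (intro notI) simp
  then obtain k where mk: "m = Suc k" by (cases m) auto
  have "\<not> s < 2 ^ k" using not_less_Least[of k "\<lambda>n. s < 2 ^ n"] mk m_def by auto
  then show ?thesis using m that[of k] unfolding mk by simp
qed

lemma (in prob_space) prob_history_Int:
  assumes ind: "indep_vars (\<lambda>_. borel) \<xi> UNIV" and i: "i \<notin> A"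
    and Q: "{u \<in> space (PiM A (\<lambda>_. borel)). Q u} \<in> sets (PiM A (\<lambda>_. borel))"
    and R: "R \<in> sets borel"
  shows "prob {\<omega>\<in>space M. Q (restrict (\<lambda>j. \<xi> j \<omega>) A) \<and> (\<xi> i \<omega> :: real) \<in> R} =
     prob {\<omega>\<in>space M. Q (restrict (\<lambda>j. \<xi> j \<omega>) A)} * prob {\<omega>\<in>space M. \<xi> i \<omega> \<in> R}"
proof -
  let ?S = "PiM A (\<lambda>_. borel) :: (_ \<Rightarrow> real) measure" and ?T = "PiM {i} (\<lambda>_. borel) :: (_ \<Rightarrow> real) measure"
  let ?Y = "{u \<in> space ?T. u i \<in> R}"
  have Y: "?Y \<in> sets ?T" using R by measurable
  have *: "restrict (\<lambda>j. \<xi> j \<omega>) A \<in> space ?S" "restrict (\<lambda>j. \<xi> j \<omega>) {i} \<in> space ?T" for \<omega>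
    by (simp_all add: space_PiM)
  show ?thesis
    using indep_varD[OF indep_var_history[OF ind i] Q Y]
    by (simp add: vimage_def Int_def * conj_ac cong: conj_cong)
qed

section \<open>Crossing bounds in terms of the tail \<open>V\<close> and the variance
  \<open>v\<close> of the increments\<close>

locale centred_walk = prob_space M for M :: "'a measure" +
  fixes \<xi> :: "nat \<Rightarrow> 'a \<Rightarrow> real" and V :: "real \<Rightarrow> real" and v :: real
  assumes indep: "indep_vars (\<lambda>_. borel) \<xi> UNIV"
    and int: "\<And>n. integrable M (\<xi> n)" and int2: "\<And>n. integrable M (\<lambda>\<omega>. (\<xi> n \<omega>)\<^sup>2)"
    and mean: "\<And>n. expectation (\<xi> n) = 0"
    and var: "\<And>n. expectation (\<lambda>\<omega>. (\<xi> n \<omega>)\<^sup>2) = v"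
    and tail: "\<And>n u. prob {\<omega>\<in>space M. \<xi> n \<omega> > u} = V u"
begin

lemma increment_measurable[measurable]: "\<xi> n \<in> borel_measurable M"
  using int by (rule borel_measurable_integrable)

lemmas walk_measurable[measurable] = random_walk_measurable[OF indep]

lemma v_nonneg: "v \<ge> 0"
  unfolding var[of 0, symmetric] by (rule Bochner_Integration.integral_nonneg) simp

lemma V_nonneg: "V u \<ge> 0"
  using measure_nonneg[of M "{\<omega>\<in>space M. \<xi> 0 \<omega> > u}"] unfolding tail .

text \<open>One jump from inside the cone carries the walk above the line. Events with different
  jump times are disjoint, because after the jump the walk is outside the cone (here
  \<open>\<delta> \<le> 1\<close> enters), and independence factors each into a cone probability and
  a tail. If \<open>1 - v / (\<delta>\<^sup>2 * a * x)\<close> is negative, \<open>ennreal\<close>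
  turns it into 0.\<close>

lemma walk_exceeds_lower:
  assumes "a > 0" "x > 0" "0 < \<delta>" "\<delta> \<le> 1"
  shows "(\<Sum>n. ennreal (V ((1 + \<delta>) * (x + a * real (Suc n))))) * ennreal (1 - v / (\<delta>\<^sup>2 * a * x))
    \<le> emeasure M {\<omega>\<in>space M. \<exists>k. random_walk \<xi> k \<omega> > x + a * real k}"
proof -
  let ?S = "random_walk \<xi>"
  \<comment> \<open>\<open>\<xi> n\<close> leads from time \<open>n\<close> to time
    \<open>Suc n\<close>: the cone condition runs up to \<open>n\<close>, but the jump is measured
    against the line at \<open>Suc n\<close>. Inside the cone the walk is below 0 by less than the
    fraction \<open>\<delta>\<close> of that height, hence the threshold
    \<open>1 + \<delta>\<close>.\<close>
  define G where "G n = {\<omega>\<in>space M. \<forall>k\<le>n. \<bar>?S k \<omega>\<bar> < \<delta> * (x + a * real k)}" for n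
  define R where "R n = {(1 + \<delta>) * (x + a * real (Suc n))<..}" for n
  define E where "E n = {\<omega>\<in>G n. \<xi> n \<omega> \<in> R n}" for n
  have [measurable]: "G n \<in> events" for n unfolding G_def by measurable
  have [measurable]: "R n \<in> sets borel" for n unfolding R_def by measurable
  have E: "E n \<in> events" for n unfolding E_def by measurable
  have G: "prob (G n) \<ge> 1 - v / (\<delta>\<^sup>2 * a * x)" for n
  proof -
    let ?N = "{\<omega>\<in>space M. \<exists>k. \<bar>?S k \<omega>\<bar> \<ge> \<delta> * x + (\<delta> * a) * real k}"
    have "prob ?N \<le> v / ((\<delta> * a) * (\<delta> * x))"
      by (rule walk_crosses_line[OF indep int int2 mean]) (use assms var in auto)
    then have "1 - v / (\<delta>\<^sup>2 * a * x) \<le> 1 - prob ?N" by (simp add: power2_eq_square mult_ac)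
    also have "\<dots> = prob (space M - ?N)" by (subst prob_compl) auto
    also have "\<dots> \<le> prob (G n)"
      by (rule finite_measure_mono) (auto simp: G_def algebra_simps not_le)
    finally show ?thesis .
  qed
  have up: "?S (Suc n) \<omega> > x + a * real (Suc n)" if "\<omega> \<in> E n" for n \<omega>
  proof -
    have "\<bar>?S n \<omega>\<bar> < \<delta> * (x + a * real n)" "\<xi> n \<omega> > (1 + \<delta>) * (x + a * real (Suc n))"
      using that unfolding E_def G_def R_def by auto
    moreover have "\<delta> * (x + a * real n) \<le> \<delta> * (x + a * real (Suc n))"
      using assms by (intro mult_left_mono) auto
    ultimately show ?thesis by (simp add: random_walk_def algebra_simps)
  qed
  have "disjoint_family E"
    unfolding disjoint_family_on_def
  proof (intro ballI impI)
    have "E m \<inter> E n = {}" if "m < n" for m n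
    proof -
      have False if w: "\<omega> \<in> E m" "\<omega> \<in> E n" for \<omega>
      proof -
        have "\<bar>?S (Suc m) \<omega>\<bar> < \<delta> * (x + a * real (Suc m))"
          using w(2) \<open>m < n\<close> Suc_leI[OF \<open>m < n\<close>] unfolding E_def G_def by blast
        also have "\<dots> \<le> 1 * (x + a * real (Suc m))"
          using assms by (intro mult_right_mono) auto
        finally show False using up[OF w(1)] by simp
      qed
      then show ?thesis by auto
    qed
    then show "E m \<inter> E n = {}" if "m \<noteq> n" for m n
      using that by (metis Int_commute nat_neq_iff)
  qed
  have PE: "prob (E n) = prob (G n) * V ((1 + \<delta>) * (x + a * real (Suc n)))" for n
  proof -
    let ?B = "PiM {..<n} (\<lambda>_. borel) :: (nat \<Rightarrow> real) measure"
    define Q where "Q u \<longleftrightarrow> (\<forall>k\<in>{..n}. \<bar>\<Sum>i<k. u i\<bar> < \<delta> * (x + a * real k))" for u :: "nat \<Rightarrow> real"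
    have Q: "{u \<in> space ?B. Q u} \<in> sets ?B"
      unfolding Q_def
    proof (intro sets.sets_Collect_finite_All)
      fix k assume "k \<in> {..n}"
      then have [measurable]: "(\<lambda>u. \<Sum>i<k. u i) \<in> borel_measurable ?B"
        by (intro borel_measurable_sum measurable_component_singleton) auto
      show "{u \<in> space ?B. \<bar>\<Sum>i<k. u i\<bar> < \<delta> * (x + a * real k)} \<in> sets ?B" by measurable
    qed simp
    have eq: "Q (restrict (\<lambda>i. \<xi> i \<omega>) {..<n}) \<longleftrightarrow> (\<forall>k\<le>n. \<bar>?S k \<omega>\<bar> < \<delta> * (x + a * real k))" for \<omega>
      by (simp add: Q_def random_walk_def Ball_def)
    have "prob {\<omega>\<in>space M. Q (restrict (\<lambda>i. \<xi> i \<omega>) {..<n}) \<and> \<xi> n \<omega> \<in> R n} =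
      prob {\<omega>\<in>space M. Q (restrict (\<lambda>i. \<xi> i \<omega>) {..<n})} * prob {\<omega>\<in>space M. \<xi> n \<omega> \<in> R n}"
      by (rule prob_history_Int[OF indep _ Q]) auto
    moreover have "prob {\<omega>\<in>space M. \<xi> n \<omega> \<in> R n} = V ((1 + \<delta>) * (x + a * real (Suc n)))"
      unfolding R_def using tail[where n=n] by simp
    moreover have "{\<omega>\<in>space M. Q (restrict (\<lambda>i. \<xi> i \<omega>) {..<n}) \<and> \<xi> n \<omega> \<in> R n} = E n"
      unfolding eq E_def G_def by auto
    moreover have "{\<omega>\<in>space M. Q (restrict (\<lambda>i. \<xi> i \<omega>) {..<n})} = G n"
      unfolding eq G_def by auto
    ultimately show ?thesis by simp
  qed
  have "(\<Sum>n. ennreal (V ((1 + \<delta>) * (x + a * real (Suc n))))) * ennreal (1 - v / (\<delta>\<^sup>2 * a * x))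
      = (\<Sum>n. ennreal (V ((1 + \<delta>) * (x + a * real (Suc n)))) * ennreal (1 - v / (\<delta>\<^sup>2 * a * x)))"
    by simp
  also have "\<dots> \<le> (\<Sum>n. emeasure M (E n))"
  proof (intro suminf_le summableI)
    fix n
    have "ennreal (V ((1 + \<delta>) * (x + a * real (Suc n)))) * ennreal (1 - v / (\<delta>\<^sup>2 * a * x))
      \<le> ennreal (V ((1 + \<delta>) * (x + a * real (Suc n)))) * ennreal (prob (G n))"
      by (intro mult_left_mono ennreal_leI G) auto
    also have "\<dots> = emeasure M (E n)"
      by (simp only: emeasure_eq_measure PE ennreal_mult[symmetric] V_nonneg measure_nonneg mult.commute)
    finally show "ennreal (V ((1 + \<delta>) * (x + a * real (Suc n)))) * ennreal (1 - v / (\<delta>\<^sup>2 * a * x)) \<le> emeasure M (E n)" .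
  qed
  also have "\<dots> = emeasure M (\<Union>n. E n)"
    by (rule suminf_emeasure) (use E \<open>disjoint_family E\<close> in auto)
  also have "\<dots> \<le> emeasure M {\<omega>\<in>space M. \<exists>k. ?S k \<omega> > x + a * real k}"
  proof (rule emeasure_mono)
    show "(\<Union>n. E n) \<subseteq> {\<omega>\<in>space M. \<exists>k. ?S k \<omega> > x + a * real k}"
      using up by (fastforce simp only: E_def G_def)
  qed measurable
  finally show ?thesis .
qed

text \<open>The walk with increment \<open>i\<close> replaced by 0 is a function of the other
  increments, so its crossing is independent of the jump; it is still centred with second moments at
  most \<open>v\<close>, so \<open>walk_crosses_line\<close> applies to it.\<close>

lemma jump_and_cross_line:
  assumes "t > 0" "b > 0"
  shows "emeasure M {\<omega>\<in>space M. (\<exists>k. \<bar>random_walk (\<lambda>j. if j = i then (\<lambda>_. 0) else \<xi> j) k \<omega>\<bar> \<ge> t + b * real k)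
      \<and> \<xi> i \<omega> \<in> {y<..}} \<le> ennreal (V y) * ennreal (v / (b * t))"
proof -
  let ?\<xi> = "\<lambda>j. if j = i then (\<lambda>_. 0) else \<xi> j"
  let ?A = "- {i}"
  let ?B = "PiM ?A (\<lambda>_. borel) :: (nat \<Rightarrow> real) measure"
  \<comment> \<open>The sum leaves out \<open>i\<close>, where a family restricted to
    \<open>- {i}\<close> has the value \<open>undefined\<close>.\<close>
  define Q where "Q u \<longleftrightarrow> (\<exists>k. \<bar>\<Sum>j\<in>{..<k} - {i}. u j\<bar> \<ge> t + b * real k)" for u :: "nat \<Rightarrow> real"
  have Q: "{u \<in> space ?B. Q u} \<in> sets ?B"
    unfolding Q_def
  proof (intro sets.sets_Collect_countable_Ex)
    fix k
    have [measurable]: "(\<lambda>u. \<Sum>j\<in>{..<k} - {i}. u j) \<in> borel_measurable ?B"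
      by (intro borel_measurable_sum measurable_component_singleton) auto
    show "{u \<in> space ?B. \<bar>\<Sum>j\<in>{..<k} - {i}. u j\<bar> \<ge> t + b * real k} \<in> sets ?B" by measurable
  qed
  have "(\<Sum>j\<in>{..<k} - {i}. restrict (\<lambda>i. \<xi> i \<omega>) ?A j) = random_walk ?\<xi> k \<omega>" for k \<omega>
    unfolding random_walk_def by (rule sum.mono_neutral_cong_left) auto
  then have eq: "Q (restrict (\<lambda>i. \<xi> i \<omega>) ?A) \<longleftrightarrow> (\<exists>k. \<bar>random_walk ?\<xi> k \<omega>\<bar> \<ge> t + b * real k)" for \<omega>
    by (simp add: Q_def)
  have "indep_vars (\<lambda>_. borel) (\<lambda>j. (if j = i then (\<lambda>_. 0) else (\<lambda>y. y)) \<circ> \<xi> j) UNIV"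
    by (rule indep_vars_compose[OF indep]) auto
  also have "(\<lambda>j. (if j = i then (\<lambda>_. 0) else (\<lambda>y. y)) \<circ> \<xi> j) = ?\<xi>" by (auto simp: fun_eq_iff)
  finally have ind': "indep_vars (\<lambda>_. borel) ?\<xi> UNIV" .
  have "prob {\<omega>\<in>space M. \<exists>k. \<bar>random_walk ?\<xi> k \<omega>\<bar> \<ge> t + b * real k} \<le> v / (b * t)"
    by (rule walk_crosses_line[OF ind']) (use int int2 mean var v_nonneg assms in auto)
  moreover have "prob {\<omega>\<in>space M. (\<exists>k. \<bar>random_walk ?\<xi> k \<omega>\<bar> \<ge> t + b * real k) \<and> \<xi> i \<omega> \<in> {y<..}}
    = V y * prob {\<omega>\<in>space M. \<exists>k. \<bar>random_walk ?\<xi> k \<omega>\<bar> \<ge> t + b * real k}"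
    using prob_history_Int[OF indep _ Q, where i=i and R="{y<..}"] tail[of y i] unfolding eq by simp
  ultimately have "prob {\<omega>\<in>space M. (\<exists>k. \<bar>random_walk ?\<xi> k \<omega>\<bar> \<ge> t + b * real k) \<and> \<xi> i \<omega> \<in> {y<..}}
    \<le> V y * (v / (b * t))"
    using mult_left_mono[OF _ V_nonneg, of _ "v / (b * t)" y] by simp
  then show ?thesis
    unfolding emeasure_eq_measure
    using v_nonneg assms by (subst ennreal_mult[symmetric]) (auto intro!: ennreal_leI V_nonneg)
qed

text \<open>An exceeding path has a large jump (\<open>A\<close>), a medium jump (\<open>B\<close>),
  or only jumps at most \<open>\<theta>\<close> times the line (\<open>C\<close>). The probabilities
  are added by countable subadditivity, over the jump times for \<open>A\<close> and
  \<open>B\<close> and over the dyadic heights for \<open>C\<close>.\<close>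

lemma walk_exceeds_upper:
  assumes "a > 0" "x > 0" "0 < \<delta>" "\<delta> < 1" "0 < \<theta>"
    and w: "\<And>j. w j = (1 + 2 ^ j) * x / 2" and h: "\<And>j. h j > 0"
    and mgf: "\<And>j n. (\<integral>\<^sup>+\<omega>. ennreal (exp (h j * min (\<xi> n \<omega>) (4 * \<theta> * w j))) \<partial>M) \<le> ennreal (exp (h j * (a / 2)))"
  shows "emeasure M {\<omega>\<in>space M. \<exists>k. random_walk \<xi> k \<omega> > x + a * real k} \<le>
     (\<Sum>n. ennreal (V ((1 - \<delta>) * (x + a * real (Suc n))))) +
     (\<Sum>n. ennreal (V (\<theta> * (x + a * real (Suc n))))) * ennreal (v / (\<delta>\<^sup>2 * a * x)) +
     (\<Sum>j. ennreal (exp (- (h j * w j))))"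
proof -
  let ?S = "random_walk \<xi>"
  let ?\<xi> = "\<lambda>i j. if j = i then (\<lambda>_. 0) else \<xi> j"
  define A where "A i = {\<omega>\<in>space M. \<xi> i \<omega> > (1 - \<delta>) * (x + a * real (Suc i))}" for i
  define B where "B i = {\<omega>\<in>space M. (\<exists>k. \<bar>random_walk (?\<xi> i) k \<omega>\<bar> \<ge> \<delta> * x + \<delta> * a * real k)
      \<and> \<xi> i \<omega> \<in> {\<theta> * (x + a * real (Suc i))<..}}" for i
  define C where "C j = {\<omega>\<in>space M. \<exists>k. random_walk (\<lambda>i \<omega>. min (\<xi> i \<omega>) (4 * \<theta> * w j)) k \<omega> \<ge> w j + a / 2 * real k}" for j
  have A[measurable]: "A i \<in> events" for i unfolding A_def by measurable
  have B[measurable]: "B i \<in> events" for i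
  proof -
    have [measurable]: "random_walk (?\<xi> i) k \<in> borel_measurable M" for k
    proof -
      have [measurable]: "?\<xi> i j \<in> borel_measurable M" for j by simp
      show ?thesis unfolding random_walk_def by (rule borel_measurable_sum) simp
    qed
    show ?thesis unfolding B_def by measurable
  qed
  have C[measurable]: "C j \<in> events" for j unfolding C_def random_walk_def by measurable
  have eA: "emeasure M (A i) = ennreal (V ((1 - \<delta>) * (x + a * real (Suc i))))" for i
    unfolding A_def emeasure_eq_measure tail ..
  have eB: "emeasure M (B i) \<le> ennreal (V (\<theta> * (x + a * real (Suc i)))) * ennreal (v / (\<delta>\<^sup>2 * a * x))" for i
    using jump_and_cross_line[of "\<delta> * x" "\<delta> * a" i "\<theta> * (x + a * real (Suc i))"] assms
    unfolding B_def by (simp add: power2_eq_square mult_ac)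
  have eC: "emeasure M (C j) \<le> ennreal (exp (- (h j * w j)))" for j
    unfolding C_def
  proof (rule exp_walk_crosses_line[OF _ mgf h])
    show "indep_vars (\<lambda>_. borel) (\<lambda>i \<omega>. min (\<xi> i \<omega>) (4 * \<theta> * w j)) UNIV"
      by (rule indep_vars_compose2[OF indep]) auto
  qed
  have sub: "{\<omega>\<in>space M. \<exists>k. ?S k \<omega> > x + a * real k} \<subseteq> ((\<Union>i. A i) \<union> (\<Union>i. B i)) \<union> (\<Union>j. C j)"
  proof (intro subsetI, elim CollectE conjE exE)
    fix \<omega> k assume sp: "\<omega> \<in> space M" and k: "?S k \<omega> > x + a * real k"
    define z where "z = x + a * real k"
    have z: "z \<ge> x" "z > 0" using assms by (auto simp: z_def intro: add_pos_nonneg)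
    have iz: "x + a * real (Suc i) \<le> z" if "i < k" for i
      using that assms unfolding z_def by (intro add_left_mono mult_left_mono) auto
    consider (A) i where "i < k" "\<xi> i \<omega> > (1 - \<delta>) * (x + a * real (Suc i))"
      | (B) i where "i < k" "\<xi> i \<omega> > \<theta> * (x + a * real (Suc i))" "\<xi> i \<omega> \<le> (1 - \<delta>) * (x + a * real (Suc i))"
      | (C) "\<forall>i<k. \<xi> i \<omega> \<le> \<theta> * (x + a * real (Suc i))"
      using not_le by blast
    then show "\<omega> \<in> ((\<Union>i. A i) \<union> (\<Union>i. B i)) \<union> (\<Union>j. C j)"
    proof cases
      case A
      then show ?thesis using sp by (auto simp: A_def)
    next
      case B
      have "?S k \<omega> = random_walk (?\<xi> i) k \<omega> + \<xi> i \<omega>"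
        using B(1) unfolding random_walk_def
        by (subst (1 2) sum.remove[of _ i]) (auto intro!: sum.cong)
      \<comment> \<open>The medium jump covers at most the part \<open>1 - \<delta>\<close> of the
        height \<open>z\<close> at the crossing time, so the remaining increments must supply the
        part \<open>\<delta>\<close> and leave their cone.\<close>
      moreover have "(1 - \<delta>) * (x + a * real (Suc i)) \<le> (1 - \<delta>) * z"
        using assms by (intro mult_left_mono iz B) auto
      ultimately have "\<delta> * z \<le> random_walk (?\<xi> i) k \<omega>"
        using B(3) k by (simp add: z_def[symmetric] algebra_simps)
      then have "\<delta> * x + \<delta> * a * real k \<le> \<bar>random_walk (?\<xi> i) k \<omega>\<bar>"
        by (simp add: z_def algebra_simps)
      then show ?thesis using sp B(2) by (auto simp: B_def)
    next
      case C
      obtain j :: nat where j: "2 ^ j * x \<le> z" "z < 2 ^ Suc j * x"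
        using dyadic_bracket[of "z / x"] z assms by (auto simp: field_simps)
      \<comment> \<open>Since \<open>z < 2 ^ Suc j * x\<close> and this is at most
        \<open>4 * w j\<close>, truncation at \<open>4 * \<theta> * w j\<close> leaves the first
        \<open>k\<close> increments unchanged.\<close>
      have "\<xi> i \<omega> \<le> 4 * \<theta> * w j" if "i < k" for i
      proof -
        have "\<xi> i \<omega> \<le> \<theta> * z"
          using C that iz[OF that] assms by (meson mult_left_mono order_trans less_imp_le)
        also have "\<dots> \<le> \<theta> * (2 ^ Suc j * x)" using j assms by (intro mult_left_mono) auto
        also have "\<dots> \<le> 4 * \<theta> * w j" using assms by (simp add: w algebra_simps)
        finally show ?thesis .
      qed
      then have "random_walk (\<lambda>i \<omega>. min (\<xi> i \<omega>) (4 * \<theta> * w j)) k \<omega> = ?S k \<omega>"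
        unfolding random_walk_def by (intro sum.cong) (auto simp: min_def intro: antisym)
      \<comment> \<open>\<open>w j\<close> is the midpoint of \<open>x\<close> and
        \<open>2 ^ j * x\<close>, so the left side is the midpoint of \<open>z\<close> and
        \<open>2 ^ j * x\<close>. This is where half of the drift is traded for height.\<close>
      moreover have "w j + a / 2 * real k \<le> z"
      proof -
        have "w j = x / 2 + 2 ^ j * x / 2" by (simp add: w field_simps)
        then show ?thesis using j(1) unfolding z_def by linarith
      qed
      ultimately have "\<omega> \<in> C j" using sp k unfolding C_def z_def by (auto intro!: exI[of _ k])
      then show ?thesis by blast
    qed
  qed
  have "emeasure M {\<omega>\<in>space M. \<exists>k. ?S k \<omega> > x + a * real k} \<le> emeasure M (((\<Union>i. A i) \<union> (\<Union>i. B i)) \<union> (\<Union>j. C j))"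
    by (rule emeasure_mono[OF sub]) measurable
  also have "\<dots> \<le> emeasure M ((\<Union>i. A i) \<union> (\<Union>i. B i)) + emeasure M (\<Union>j. C j)"
    by (rule emeasure_subadditive) measurable
  also have "\<dots> \<le> (emeasure M (\<Union>i. A i) + emeasure M (\<Union>i. B i)) + emeasure M (\<Union>j. C j)"
    by (intro add_mono emeasure_subadditive order_refl) measurable
  also have "\<dots> \<le> ((\<Sum>i. emeasure M (A i)) + (\<Sum>i. emeasure M (B i))) + (\<Sum>j. emeasure M (C j))"
    by (intro add_mono emeasure_subadditive_countably) auto
  also have "\<dots> \<le> ((\<Sum>n. ennreal (V ((1 - \<delta>) * (x + a * real (Suc n))))) +
     (\<Sum>n. ennreal (V (\<theta> * (x + a * real (Suc n)))) * ennreal (v / (\<delta>\<^sup>2 * a * x)))) +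
     (\<Sum>j. ennreal (exp (- (h j * w j))))"
    unfolding eA by (intro add_mono suminf_le summableI eB eC order_refl)
  finally show ?thesis by simp
qed

text \<open>Where \<open>h * \<xi> n\<close> is at most 1, a quadratic bound on \<open>exp\<close>
  is used, whose linear term has mean 0; elsewhere the truncation bounds the exponential by
  \<open>exp (h * y)\<close>, on an event of probability \<open>V (1 / h)\<close>.\<close>

lemma exp_min_le:
  assumes h: "h > 0" and y: "y > 0"
  shows "(\<integral>\<^sup>+\<omega>. ennreal (exp (h * min (\<xi> n \<omega>) y)) \<partial>M) \<le>
     ennreal (1 + exp 1 / 2 * h\<^sup>2 * v + exp (h * y) * V (1 / h))"
proof -
  \<comment> \<open>For \<open>u \<ge> -1\<close> the factor \<open>exp 1 / 2\<close> bounds the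
    Lagrange remainder, whose intermediate point is at most 1. For \<open>u < -1\<close> the left
    side is at most 1, and the quadratic term outweighs \<open>u\<close> because
    \<open>exp 1 / 2 \<ge> 1\<close>.\<close>
  have taylor: "exp u \<le> 1 + u + exp 1 / 2 * u\<^sup>2" if "u \<le> 1" for u :: real
  proof (cases "u \<ge> -1")
    case True
    obtain t where t: "\<bar>t\<bar> \<le> \<bar>u\<bar>" "exp u = (\<Sum>m<2. u ^ m / fact m) + exp t / fact 2 * u ^ 2"
      using Maclaurin_exp_le[of u 2] by auto
    have "exp t / 2 * u\<^sup>2 \<le> exp 1 / 2 * u\<^sup>2" using t(1) True that by (intro mult_right_mono) auto
    then show ?thesis using t(2) by (simp add: numeral_2_eq_2)
  next
    case False
    have "exp u \<le> 1" using False by simp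
    moreover have "u * (exp 1 / 2 * u + 1) \<ge> 0"
    proof (rule mult_nonpos_nonpos)
      have "exp 1 \<ge> (2::real)" using exp_ge_add_one_self[of 1] by simp
      then have "exp 1 / 2 * u \<le> 1 * u" using False by (intro mult_right_mono_neg) auto
      then show "exp 1 / 2 * u + 1 \<le> 0" using False by linarith
    qed (use False in simp)
    moreover have "u * (exp 1 / 2 * u + 1) = u + exp 1 / 2 * u\<^sup>2"
      by (simp add: power2_eq_square algebra_simps)
    ultimately show ?thesis by linarith
  qed
  let ?I = "\<lambda>\<omega>. indicator {\<omega>\<in>space M. \<xi> n \<omega> > 1 / h} \<omega> :: real"
  let ?f = "\<lambda>\<omega>. 1 + h * \<xi> n \<omega> + exp 1 / 2 * h\<^sup>2 * (\<xi> n \<omega>)\<^sup>2 + exp (h * y) * ?I \<omega>"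
  have le: "exp (h * min (\<xi> n \<omega>) y) \<le> ?f \<omega>" if "\<omega> \<in> space M" for \<omega>
  proof (cases "\<xi> n \<omega> > 1 / h")
    case True
    have "exp (h * min (\<xi> n \<omega>) y) \<le> exp (h * y)"
      unfolding exp_le_cancel_iff using h by (intro mult_left_mono) auto
    moreover have "\<xi> n \<omega> > 0" using True h by (rule_tac less_trans[of _ "1 / h"]) auto
    then have "h * \<xi> n \<omega> > 0" using h by simp
    moreover have "exp 1 / 2 * h\<^sup>2 * (\<xi> n \<omega>)\<^sup>2 \<ge> 0" by simp
    moreover have "?f \<omega> = 1 + h * \<xi> n \<omega> + exp 1 / 2 * h\<^sup>2 * (\<xi> n \<omega>)\<^sup>2 + exp (h * y)"
      using True that by simp
    ultimately show ?thesis by linarith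
  next
    case False
    then have "h * \<xi> n \<omega> \<le> 1" using h by (simp add: field_simps)
    have "exp (h * min (\<xi> n \<omega>) y) \<le> exp (h * \<xi> n \<omega>)" using h by simp
    also have "\<dots> \<le> 1 + h * \<xi> n \<omega> + exp 1 / 2 * (h * \<xi> n \<omega>)\<^sup>2" by (rule taylor) fact
    finally show ?thesis using False by (simp add: power_mult_distrib)
  qed
  have I: "integrable M ?I"
    by (rule integrable_real_indicator) (auto simp: less_top[symmetric])
  have EI: "expectation ?I = V (1 / h)"
    unfolding tail[where n=n, symmetric]
    by (subst Bochner_Integration.integral_indicator) (auto intro!: arg_cong[where f=prob])
  have i: "integrable M ?f"
    using int int2 I by (intro Bochner_Integration.integrable_add integrable_mult_right) auto
  have "(\<integral>\<^sup>+\<omega>. ennreal (exp (h * min (\<xi> n \<omega>) y)) \<partial>M) \<le> (\<integral>\<^sup>+\<omega>. ennreal (?f \<omega>) \<partial>M)"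
    by (intro nn_integral_mono ennreal_leI le)
  also have "\<dots> = ennreal (expectation ?f)"
    by (intro nn_integral_eq_integral i AE_I2 order_trans[OF _ le]) auto
  also have "expectation ?f = 1 + exp 1 / 2 * h\<^sup>2 * v + exp (h * y) * V (1 / h)"
    using int int2 mean var I EI by (simp add: prob_space)
  finally show ?thesis .
qed

end

section \<open>Regularly varying tails\<close>

lemma nn_integral_powr_atLeast:
  assumes "\<rho> > 1"
  shows "(\<integral>\<^sup>+s. ennreal (s powr - \<rho>) * indicator {1::real..} s \<partial>lborel) = ennreal (1 / (\<rho> - 1))"
proof -
  define F where "F s = - (s powr (1 - \<rho>)) / (\<rho> - 1)" for s :: real
  have "(\<integral>\<^sup>+s. ennreal (s powr - \<rho>) * indicator {1..} s \<partial>lborel) = ennreal (0 - F 1)"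
  proof (rule nn_integral_FTC_atLeast)
    show "(F has_real_derivative s powr - \<rho>) (at s)" if "1 \<le> s" for s
    proof -
      have "((\<lambda>s. s powr (1 - \<rho>)) has_real_derivative (1 - \<rho>) * s powr (1 - \<rho> - 1)) (at s)"
        by (rule has_real_derivative_powr) (use that in auto)
      from DERIV_cdivide[OF DERIV_minus[OF this], of "\<rho> - 1"]
      show ?thesis unfolding F_def by (rule DERIV_cong) (use assms in \<open>simp add: field_simps\<close>)
    qed
    show "(F \<longlongrightarrow> 0) at_top" unfolding F_def using assms by real_asymp
  qed auto
  then show ?thesis by (simp add: F_def)
qed

lemma has_bochner_integral_powr_atLeast:
  assumes "\<rho> > 1"
  shows "has_bochner_integral lborel (\<lambda>s. indicator {1::real..} s * s powr - \<rho>) (1 / (\<rho> - 1))"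
proof (rule has_bochner_integral_nn_integral)
  show "(\<integral>\<^sup>+s. ennreal (indicator {1::real..} s * s powr - \<rho>) \<partial>lborel) = ennreal (1 / (\<rho> - 1))"
    unfolding nn_integral_powr_atLeast[OF assms, symmetric]
    by (intro nn_integral_cong) (auto simp: indicator_def)
qed (use assms in auto)

section \<open>Regular variation in ratio form, Potter bounds and tail integrals\<close>

locale regularly_varying_tail =
  fixes V :: "real \<Rightarrow> real" and r :: real
  assumes anti: "antimono V" and pos: "\<And>u. V u > 0"
    and rv: "\<And>c. c > 0 \<Longrightarrow> ((\<lambda>u. V (c * u) / V u) \<longlongrightarrow> c powr - r) at_top"
begin

lemma V_measurable[measurable]: "V \<in> borel_measurable borel"
proof -
  have "mono (\<lambda>u. - V u)" using anti by (auto simp: monotone_def)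
  then have "(\<lambda>u. - V u) \<in> borel_measurable borel" by (rule borel_measurable_mono)
  then show ?thesis using borel_measurable_uminus by fastforce
qed

text \<open>Doubling the argument eventually costs a factor below \<open>2 powr - \<rho>\<close>,
  and this is iterated. Monotonicity of \<open>V\<close> fills the gaps between powers of 2 in place
  of the uniform convergence theorem; rounding \<open>s\<close> down loses the factor
  \<open>C = 2 powr \<rho>\<close>.\<close>

lemma potter_upper:
  assumes "0 < \<rho>" "\<rho> < r"
  obtains C x0 where "C > 0" "x0 > 0" "\<And>x s. x \<ge> x0 \<Longrightarrow> s \<ge> 1 \<Longrightarrow> V (x * s) \<le> C * s powr - \<rho> * V x"
proof -
  have "eventually (\<lambda>u. V (2 * u) / V u < 2 powr - \<rho>) at_top"
    using rv[of 2] assms by (intro order_tendstoD(2)) auto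
  then obtain x1 where x1: "\<And>u. u \<ge> x1 \<Longrightarrow> V (2 * u) / V u < 2 powr - \<rho>"
    by (auto simp: eventually_at_top_linorder)
  define x0 where "x0 = max x1 1"
  have step: "V (2 * u) \<le> 2 powr - \<rho> * V u" if "u \<ge> x0" for u
    using x1[of u] that pos[of u] by (simp add: x0_def field_simps)
  have iter: "V (2 ^ k * x) \<le> (2 ^ k) powr - \<rho> * V x" if x: "x \<ge> x0" for k :: nat and x
  proof (induction k)
    case (Suc k)
    have "2 ^ k * x \<ge> 1 * x" using x by (intro mult_right_mono) (auto simp: x0_def)
    then have "V (2 ^ Suc k * x) \<le> 2 powr - \<rho> * V (2 ^ k * x)"
      using step[of "2 ^ k * x"] x by (simp add: mult_ac)
    also have "\<dots> \<le> 2 powr - \<rho> * ((2 ^ k) powr - \<rho> * V x)"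
      by (intro mult_left_mono Suc) auto
    also have "\<dots> = (2 ^ Suc k) powr - \<rho> * V x" by (simp add: powr_mult)
    finally show ?case .
  qed simp
  show ?thesis
  proof (rule that[of "2 powr \<rho>" x0])
    fix x s :: real assume x: "x \<ge> x0" and s: "s \<ge> 1"
    obtain k :: nat where k: "2 ^ k \<le> s" "s < 2 ^ Suc k" using dyadic_bracket[OF s] .
    have "V (x * s) \<le> V (2 ^ k * x)"
      using k(1) x by (intro antimonoD[OF anti]) (simp add: x0_def mult.commute mult_left_mono)
    also have "\<dots> \<le> (2 ^ k) powr - \<rho> * V x" by (rule iter[OF x])
    also have "\<dots> \<le> (s / 2) powr - \<rho> * V x"
      using k s assms pos[of x] by (intro mult_right_mono powr_mono2') auto
    also have "(s / 2) powr - \<rho> = 2 powr \<rho> * s powr - \<rho>"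
      using s by (simp add: powr_divide powr_minus field_simps)
    finally show "V (x * s) \<le> 2 powr \<rho> * s powr - \<rho> * V x" .
  qed (auto simp: x0_def)
qed

text \<open>Doubling as for the upper bound, but \<open>s\<close> is rounded up to a power of 2,
  with loss \<open>2 powr - \<rho>\<close>.\<close>

lemma potter_lower:
  assumes "0 < \<rho>" "r < \<rho>"
  obtains c x0 where "c > 0" "x0 > 0" "\<And>x s. x \<ge> x0 \<Longrightarrow> s \<ge> 1 \<Longrightarrow> V (x * s) \<ge> c * s powr - \<rho> * V x"
proof -
  have "eventually (\<lambda>u. V (2 * u) / V u > 2 powr - \<rho>) at_top"
    using rv[of 2] assms by (intro order_tendstoD(1)) auto
  then obtain x1 where x1: "\<And>u. u \<ge> x1 \<Longrightarrow> V (2 * u) / V u > 2 powr - \<rho>"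
    by (auto simp: eventually_at_top_linorder)
  define x0 where "x0 = max x1 1"
  have step: "V (2 * u) \<ge> 2 powr - \<rho> * V u" if "u \<ge> x0" for u
    using x1[of u] that pos[of u] by (simp add: x0_def field_simps)
  have iter: "V (2 ^ k * x) \<ge> (2 ^ k) powr - \<rho> * V x" if x: "x \<ge> x0" for k :: nat and x
  proof (induction k)
    case (Suc k)
    have "2 ^ k * x \<ge> 1 * x" using x by (intro mult_right_mono) (auto simp: x0_def)
    have "(2 ^ Suc k) powr - \<rho> * V x = 2 powr - \<rho> * ((2 ^ k) powr - \<rho> * V x)" by (simp add: powr_mult)
    also have "\<dots> \<le> 2 powr - \<rho> * V (2 ^ k * x)"
      by (intro mult_left_mono Suc) auto
    also have "\<dots> \<le> V (2 ^ Suc k * x)"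
      using step[of "2 ^ k * x"] x \<open>2 ^ k * x \<ge> 1 * x\<close> by (simp add: mult_ac)
    finally show ?case .
  qed simp
  show ?thesis
  proof (rule that[of "2 powr - \<rho>" x0])
    fix x s :: real assume x: "x \<ge> x0" and s: "s \<ge> 1"
    obtain k :: nat where k: "2 ^ k \<le> s" "s < 2 ^ Suc k" using dyadic_bracket[OF s] .
    have "2 powr - \<rho> * s powr - \<rho> * V x = (2 * s) powr - \<rho> * V x"
      using s by (simp add: powr_mult)
    also have "\<dots> \<le> (2 ^ Suc k) powr - \<rho> * V x"
      using k s assms pos[of x] by (intro mult_right_mono powr_mono2') auto
    also have "\<dots> \<le> V (2 ^ Suc k * x)" by (rule iter[OF x])
    also have "\<dots> \<le> V (x * s)"
      using k(2) x by (intro antimonoD[OF anti]) (simp add: x0_def mult.commute mult_left_mono)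
    finally show "V (x * s) \<ge> 2 powr - \<rho> * s powr - \<rho> * V x" .
  qed (auto simp: x0_def)
qed

text \<open>The Potter bound with its base point frozen at \<open>x0\<close>.\<close>

lemma V_upper:
  assumes "0 < \<rho>" "\<rho> < r"
  obtains C x0 where "C > 0" "x0 > 0" "\<And>u. u \<ge> x0 \<Longrightarrow> V u \<le> C * u powr - \<rho>"
proof -
  obtain C x0 where C: "C > 0" "x0 > 0" "\<And>x s. x \<ge> x0 \<Longrightarrow> s \<ge> 1 \<Longrightarrow> V (x * s) \<le> C * s powr - \<rho> * V x"
    using potter_upper[OF assms] by blast
  show ?thesis
  proof (rule that[of "C * x0 powr \<rho> * V x0" x0])
    fix u assume "u \<ge> x0"
    then show "V u \<le> C * x0 powr \<rho> * V x0 * u powr - \<rho>"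
      using C(3)[of x0 "u / x0"] C(2) by (simp add: powr_divide powr_minus field_simps)
  qed (use C pos in auto)
qed

lemma V_lower:
  assumes "0 < \<rho>" "r < \<rho>"
  obtains c x0 where "c > 0" "x0 > 0" "\<And>u. u \<ge> x0 \<Longrightarrow> V u \<ge> c * u powr - \<rho>"
proof -
  obtain c x0 where C: "c > 0" "x0 > 0" "\<And>x s. x \<ge> x0 \<Longrightarrow> s \<ge> 1 \<Longrightarrow> V (x * s) \<ge> c * s powr - \<rho> * V x"
    using potter_lower[OF assms] by blast
  show ?thesis
  proof (rule that[of "c * x0 powr \<rho> * V x0" x0])
    fix u assume "u \<ge> x0"
    then show "V u \<ge> c * x0 powr \<rho> * V x0 * u powr - \<rho>"
      using C(3)[of x0 "u / x0"] C(2) by (simp add: powr_divide powr_minus field_simps)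
  qed (use C pos in auto)
qed

text \<open>A Bochner integral, hence 0 by default where \<open>V\<close> is not integrable; the
  second part of \<open>karamata\<close> rules this default out for large \<open>y\<close>.\<close>

definition tail_integral :: "real \<Rightarrow> real" where
  "tail_integral y = (\<integral>u. indicator {y..} u * V u \<partial>lborel)"

text \<open>The substitution \<open>u = y s\<close> turns \<open>tail_integral y / (y V y)\<close> into an integral to which dominated
  convergence applies, with the Potter bound as dominating function.\<close>

lemma karamata:
  assumes r: "r > 1"
  shows "((\<lambda>y. tail_integral y / (y * V y)) \<longlongrightarrow> 1 / (r - 1)) at_top"
    and "eventually (\<lambda>y. (\<integral>\<^sup>+u. ennreal (V u) * indicator {y..} u \<partial>lborel) = ennreal (tail_integral y)) at_top"
proof -
  \<comment> \<open>Any exponent strictly between 1 and \<open>r\<close> serves: above 1 the Potter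
    bound is integrable, below \<open>r\<close> it is available.\<close>
  define \<rho> where "\<rho> = (1 + r) / 2"
  have \<rho>: "1 < \<rho>" "\<rho> < r" using r by (auto simp: \<rho>_def)
  obtain C x0 where C: "C > 0" "x0 > 0" "\<And>x s. x \<ge> x0 \<Longrightarrow> s \<ge> 1 \<Longrightarrow> V (x * s) \<le> C * s powr - \<rho> * V x"
    using potter_upper[of \<rho>] \<rho> by auto
  define f where "f y s = indicator {1..} s * (V (y * s) / V y)" for y s :: real
  define g where "g s = indicator {1..} s * s powr - \<rho>" for s :: real
  have bound: "norm (f y s) \<le> C * g s" if "y \<ge> x0" for y s
    using C(3)[OF that, of s] pos[of y] pos[of "y * s"] by (auto simp: f_def g_def indicator_def field_simps)
  have g: "integrable lborel (\<lambda>s. C * g s)"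
    using has_bochner_integral_powr_atLeast[OF \<rho>(1)] unfolding g_def has_bochner_integral_iff by auto
  have fm[measurable]: "f y \<in> borel_measurable lborel" for y unfolding f_def by measurable
  have fi: "integrable lborel (f y)" if "y \<ge> x0" for y
    by (rule Bochner_Integration.integrable_bound[OF g]) (auto intro!: AE_I2 order_trans[OF bound[OF that, unfolded real_norm_def]] abs_ge_self)
  \<comment> \<open>The summand 0 matches the affine form \<open>t + c * x\<close> in the
    substitution rule for \<open>lborel\<close>.\<close>
  have subst: "indicator {y..} (0 + y * s) * V (0 + y * s) = V y * f y s" if "y > 0" for y s
    using that pos[of y] by (auto simp: f_def indicator_def)
  have lim: "((\<lambda>y. integral\<^sup>L lborel (f y)) \<longlongrightarrow> (\<integral>s. indicator {1..} s * s powr - r \<partial>lborel)) at_top"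
  proof (rule integral_dominated_convergence_at_top[where w="\<lambda>s. C * g s"])
    show "AE s in lborel. ((\<lambda>y. f y s) \<longlongrightarrow> indicator {1..} s * s powr - r) at_top"
    proof (rule AE_I2)
      fix s :: real
      show "((\<lambda>y. f y s) \<longlongrightarrow> indicator {1..} s * s powr - r) at_top"
        using rv[of s] by (cases "s \<ge> 1") (auto simp: f_def mult.commute)
    qed
    show "\<forall>\<^sub>F y in at_top. AE s in lborel. norm (f y s) \<le> C * g s"
      using eventually_ge_at_top[of x0] by eventually_elim (intro AE_I2 bound)
  qed (use g in auto)
  have Jf: "tail_integral y = y * (V y * integral\<^sup>L lborel (f y))" if "y \<ge> x0" for y
  proof -
    have y: "y > 0" using that C by simp
    have "tail_integral y = \<bar>y\<bar> *\<^sub>R (\<integral>s. indicator {y..} (0 + y * s) * V (0 + y * s) \<partial>lborel)"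
      unfolding tail_integral_def using y by (intro lborel_integral_real_affine) auto
    then show ?thesis using y unfolding subst[OF y] by simp
  qed
  have "eventually (\<lambda>y. integral\<^sup>L lborel (f y) = tail_integral y / (y * V y)) at_top"
    using eventually_ge_at_top[of x0]
  proof eventually_elim
    case (elim y)
    then show ?case using Jf[OF elim] C pos[of y] by simp
  qed
  from Lim_transform_eventually[OF lim this]
  show "((\<lambda>y. tail_integral y / (y * V y)) \<longlongrightarrow> 1 / (r - 1)) at_top"
    using has_bochner_integral_powr_atLeast[OF r] by (simp add: has_bochner_integral_iff)
  show "eventually (\<lambda>y. (\<integral>\<^sup>+u. ennreal (V u) * indicator {y..} u \<partial>lborel) = ennreal (tail_integral y)) at_top"
    using eventually_ge_at_top[of x0]
  proof eventually_elim
    case (elim y)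
    then have y: "y > 0" using C by simp
    have "integrable lborel (\<lambda>s. indicator {y..} (0 + y * s) * V (0 + y * s))"
      unfolding subst[OF y] by (intro integrable_mult_right fi elim)
    then have "integrable lborel (\<lambda>u. indicator {y..} u * V u)"
      using lborel_integrable_real_affine_iff[of y "\<lambda>u. indicator {y..} u * V u" 0] y by simp
    then have "(\<integral>\<^sup>+u. ennreal (indicator {y..} u * V u) \<partial>lborel) = ennreal (tail_integral y)"
      unfolding tail_integral_def using pos by (intro nn_integral_eq_integral) (auto simp: less_imp_le)
    moreover have "ennreal (indicator {y..} u * V u) = ennreal (V u) * indicator {y..} u" for u
      by (auto simp: indicator_def)
    ultimately show ?case by simp
  qed
qed

text \<open>Riemann sums of a decreasing function. The measure with density \<open>V\<close> is
  additive over the cells \<open>E y n\<close> of length \<open>b\<close>, and on each cell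
  \<open>V\<close> lies between its values at the two endpoints. The sum starts at
  \<open>y + b\<close>, so it uses right endpoints for the half-line from \<open>y\<close> and left
  endpoints for the one from \<open>y + b\<close>.\<close>

lemma
  assumes b: "b > 0"
  shows tail_sum_le: "(\<Sum>n. ennreal (V (y + b * real (Suc n)))) * ennreal b
      \<le> (\<integral>\<^sup>+u. ennreal (V u) * indicator {y..} u \<partial>lborel)"
    and tail_sum_ge: "(\<integral>\<^sup>+u. ennreal (V u) * indicator {y + b..} u \<partial>lborel)
      \<le> (\<Sum>n. ennreal (V (y + b * real (Suc n)))) * ennreal b"
proof -
  define \<mu> where "\<mu> = density lborel (\<lambda>u. ennreal (V u))"
  define E where "E y n = {y + b * real n..<y + b * real (Suc n)}" for y n
  have E: "E y n \<in> sets \<mu>" for y n by (simp add: \<mu>_def E_def)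
  have idx: "n = nat \<lfloor>(u - y) / b\<rfloor>" if "u \<in> E y n" for u y n
  proof -
    have "\<lfloor>(u - y) / b\<rfloor> = int n"
      using that b by (intro floor_unique) (auto simp: E_def field_simps)
    then show ?thesis by simp
  qed
  have disj: "disjoint_family (E y)" for y
    unfolding disjoint_family_on_def using idx by blast
  have un: "(\<Union>n. E y n) = {y..}" for y
  proof (intro set_eqI iffI)
    fix u assume "u \<in> {y..}"
    then have "0 \<le> (u - y) / b" using b by simp
    then have "real (nat \<lfloor>(u - y) / b\<rfloor>) \<le> (u - y) / b" "(u - y) / b < real (nat \<lfloor>(u - y) / b\<rfloor>) + 1"
      by linarith+
    then have "u \<in> E y (nat \<lfloor>(u - y) / b\<rfloor>)" using b by (simp add: E_def field_simps)
    then show "u \<in> (\<Union>n. E y n)" by blast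
  next
    fix u assume "u \<in> (\<Union>n. E y n)"
    then obtain n where "u \<in> E y n" by blast
    then have "y + b * real n \<le> u" by (simp add: E_def)
    moreover have "b * real n \<ge> 0" using b by simp
    ultimately show "u \<in> {y..}" by simp
  qed
  have tot: "(\<integral>\<^sup>+u. ennreal (V u) * indicator {y..} u \<partial>lborel) = (\<Sum>n. emeasure \<mu> (E y n))" for y
  proof -
    have "(\<Sum>n. emeasure \<mu> (E y n)) = emeasure \<mu> {y..}"
      using suminf_emeasure[of "E y" \<mu>] E disj un by auto
    then show ?thesis by (simp add: \<mu>_def emeasure_density)
  qed
  have len: "emeasure lborel (E y n) = ennreal b" for y n
    using b unfolding E_def by (subst emeasure_lborel_Ico) (auto simp: algebra_simps)
  have cst: "(\<integral>\<^sup>+u. ennreal c * indicator (E y n) u \<partial>lborel) = ennreal c * ennreal b" for c y n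
    using E[of y n] by (simp add: nn_integral_cmult_indicator \<mu>_def len)
  have Eem: "emeasure \<mu> (E y n) = (\<integral>\<^sup>+u. ennreal (V u) * indicator (E y n) u \<partial>lborel)" for y n
    unfolding \<mu>_def by (rule emeasure_density) (auto simp: E_def)
  have lo: "ennreal (V (y + b * real (Suc n))) * ennreal b \<le> emeasure \<mu> (E y n)" for y n
    unfolding Eem cst[symmetric, of _ y n]
  proof (intro nn_integral_mono)
    fix u show "ennreal (V (y + b * real (Suc n))) * indicator (E y n) u \<le> ennreal (V u) * indicator (E y n) u"
      using antimonoD[OF anti, of u "y + b * real (Suc n)"]
      by (cases "u \<in> E y n") (auto simp: E_def intro!: ennreal_leI)
  qed
  have hi: "emeasure \<mu> (E y n) \<le> ennreal (V (y + b * real n)) * ennreal b" for y n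
    unfolding Eem cst[symmetric, of _ y n]
  proof (intro nn_integral_mono)
    fix u show "ennreal (V u) * indicator (E y n) u \<le> ennreal (V (y + b * real n)) * indicator (E y n) u"
      using antimonoD[OF anti, of "y + b * real n" u]
      by (cases "u \<in> E y n") (auto simp: E_def intro!: ennreal_leI)
  qed
  show "(\<Sum>n. ennreal (V (y + b * real (Suc n)))) * ennreal b
      \<le> (\<integral>\<^sup>+u. ennreal (V u) * indicator {y..} u \<partial>lborel)"
    unfolding tot ennreal_suminf_multc[symmetric] by (intro suminf_le lo summableI)
  have shift: "y + b + b * real n = y + b * real (Suc n)" for n by (simp add: algebra_simps)
  show "(\<integral>\<^sup>+u. ennreal (V u) * indicator {y + b..} u \<partial>lborel)
      \<le> (\<Sum>n. ennreal (V (y + b * real (Suc n)))) * ennreal b"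
    unfolding tot ennreal_suminf_multc[symmetric] by (intro suminf_le summableI hi[of "y + b", unfolded shift])
qed

lemma tail_sum_le_integral:
  assumes b: "b > 0" and J: "(\<integral>\<^sup>+u. ennreal (V u) * indicator {y..} u \<partial>lborel) = ennreal (tail_integral y)"
  shows "(\<Sum>n. ennreal (V (y + b * real (Suc n)))) \<le> ennreal (tail_integral y / b)"
proof -
  let ?S = "\<Sum>n. ennreal (V (y + b * real (Suc n)))"
  have "?S = ?S * ennreal b * ennreal (1 / b)"
    using b by (simp add: mult.assoc ennreal_mult'[symmetric] del: suminf_ennreal)
  also have "\<dots> \<le> ennreal (tail_integral y) * ennreal (1 / b)"
    using tail_sum_le[OF b, of y] unfolding J by (rule mult_right_mono) simp
  also have "\<dots> = ennreal (tail_integral y / b)"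
    using b by (subst ennreal_mult''[symmetric]) auto
  finally show ?thesis .
qed

text \<open>The free endpoint \<open>y'\<close> absorbs the lost first cell, so that it can be taken
  proportional to the level.\<close>

lemma integral_le_tail_sum:
  assumes b: "b > 0" and y': "y + b \<le> y'"
    and J: "(\<integral>\<^sup>+u. ennreal (V u) * indicator {y'..} u \<partial>lborel) = ennreal (tail_integral y')"
  shows "ennreal (tail_integral y' / b) \<le> (\<Sum>n. ennreal (V (y + b * real (Suc n))))"
proof -
  let ?S = "\<Sum>n. ennreal (V (y + b * real (Suc n)))"
  have "ennreal (tail_integral y') \<le> (\<integral>\<^sup>+u. ennreal (V u) * indicator {y + b..} u \<partial>lborel)"
    unfolding J[symmetric] using y' by (intro nn_integral_mono) (auto simp: indicator_def)
  also have "\<dots> \<le> ?S * ennreal b" by (rule tail_sum_ge[OF b])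
  finally have "ennreal (tail_integral y') * ennreal (1 / b) \<le> ?S * ennreal b * ennreal (1 / b)"
    by (rule mult_right_mono) simp
  also have "?S * ennreal b * ennreal (1 / b) = ?S"
    using b by (simp add: mult.assoc ennreal_mult'[symmetric] del: suminf_ennreal)
  also have "ennreal (tail_integral y') * ennreal (1 / b) = ennreal (tail_integral y' / b)"
    using b by (subst ennreal_mult''[symmetric]) auto
  finally show ?thesis .
qed

text \<open>The bound of \<open>exp_min_le\<close> has to stay below \<open>1 + h * (a / 2)\<close>.
  The quadratic term does so if \<open>exp 1 * v * h\<close> is below \<open>a\<close> with a
  margin, and the tail term fits into that margin. \<open>\<theta>\<close> and \<open>T\<close> are
  chosen before \<open>a\<close> and \<open>w\<close>, which makes the estimate uniform over the
  levels.\<close>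

lemma exponential_tilt:
  assumes r: "r > 2" and v: "v \<ge> 0" and c: "c > 5 / 4 * exp 1 * (r - 2) * v"
  obtains \<theta> T where "\<theta> > 0" "T > 0"
    "\<And>a w h. 0 < a \<Longrightarrow> a \<le> 1 \<Longrightarrow> a * w \<ge> T \<Longrightarrow> a * w \<ge> c * ln (1 / a) \<Longrightarrow>
       h = ln (a * w powr (r - 1 + (r - 2) / 20)) / w \<Longrightarrow>
       h > 0 \<and> 1 + exp 1 / 2 * h\<^sup>2 * v + exp (h * (4 * \<theta> * w)) * V (1 / h) \<le> exp (h * (a / 2))"
proof -
  define \<kappa> where "\<kappa> = r - 2"
  \<comment> \<open>\<open>\<eta>\<close> is spent twice, in the exponent of the tilt and on
    absorbing \<open>ln t\<close>; in total
    \<open>\<kappa> + 2 * \<eta> = 11 / 10 * \<kappa>\<close>.\<close>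
  define \<eta> where "\<eta> = \<kappa> / 20"
  have \<kappa>: "\<kappa> > 0" "\<eta> > 0" using r by (auto simp: \<kappa>_def \<eta>_def)
  have c0: "c > 0" using c v r by (rule_tac le_less_trans[OF _ c]) auto
  \<comment> \<open>Replaces \<open>v\<close>, which may be \<open>0\<close> here, by a positive number.\<close>
  define v' where "v' = (v + c / (5 / 4 * exp 1 * \<kappa>)) / 2"
  have v0: "v < c / (5 / 4 * exp 1 * \<kappa>)"
    using c \<kappa> by (simp add: \<kappa>_def[symmetric] field_simps)
  have v': "v' > 0" "v \<le> v'" "v' \<le> c / (5 / 4 * exp 1 * \<kappa>)" using v0 v by (auto simp: v'_def)
  have c': "5 / 4 * exp 1 * \<kappa> * v' \<le> c" using v'(3) \<kappa> by (simp add: field_simps)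
  \<comment> \<open>With this local \<open>q\<close>, \<open>2 + q\<close> lies strictly between 2
    and \<open>r\<close>: \<open>V (1 / h)\<close> is at most a multiple of
    \<open>h powr (2 + q)\<close>, whose factor \<open>h powr q\<close> is left to beat the
    truncated exponential.\<close>
  define q where "q = \<kappa> / 2"
  have q: "q > 0" using \<kappa> by (simp add: q_def)
  obtain C x0 where C: "C > 0" "x0 > 0" "\<And>u. u \<ge> x0 \<Longrightarrow> V u \<le> C * u powr - (2 + q)"
  proof (rule V_upper)
    show "0 < 2 + q" "2 + q < r" using r by (auto simp: q_def \<kappa>_def field_simps)
  qed blast
  define r' where "r' = r + \<eta>"
  have r': "r' > 0" using r \<kappa> by (simp add: r'_def)
  \<comment> \<open>Chosen so that \<open>4 * \<theta> * r' = q / 2\<close>: the truncated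
    exponential then costs only \<open>w powr (q / 2)\<close>, while \<open>h powr q\<close> is of
    order \<open>w powr - q\<close> up to logarithms.\<close>
  define \<theta> where "\<theta> = q / (8 * r')"
  have \<theta>: "\<theta> > 0" using q r' by (simp add: \<theta>_def)
  have "eventually (\<lambda>t. (r - 1 + \<eta>) * ln t \<le> \<eta> / c * t) at_top"
  proof -
    have "((\<lambda>t. (r - 1 + \<eta>) * ln t / t) \<longlongrightarrow> 0) at_top" by real_asymp
    moreover have "\<eta> / c > 0" using \<kappa> c0 by simp
    ultimately have "eventually (\<lambda>t. (r - 1 + \<eta>) * ln t / t < \<eta> / c) at_top"
      by (rule order_tendstoD)
    then show ?thesis using eventually_gt_at_top[of 0]
      by eventually_elim (simp add: pos_divide_less_eq)
  qed
  then obtain t1 where t1: "\<And>t. t \<ge> t1 \<Longrightarrow> (r - 1 + \<eta>) * ln t \<le> \<eta> / c * t"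
    by (auto simp: eventually_at_top_linorder)
  have "eventually (\<lambda>w. C * (r' * ln w / w) powr q * w powr (q / 2) < exp 1 / 20 * v' \<and> r' * ln w / w < 1 / x0) at_top"
  proof (intro eventually_conj)
    have "((\<lambda>w. C * (r' * ln w / w) powr q * w powr (q / 2)) \<longlongrightarrow> 0) at_top"
      using q r' C by real_asymp
    then show "eventually (\<lambda>w. C * (r' * ln w / w) powr q * w powr (q / 2) < exp 1 / 20 * v') at_top"
      using v' by (rule_tac order_tendstoD) auto
    have "((\<lambda>w. r' * ln w / w) \<longlongrightarrow> 0) at_top" by real_asymp
    then show "eventually (\<lambda>w. r' * ln w / w < 1 / x0) at_top"
      using C by (rule_tac order_tendstoD) auto
  qed
  then obtain w1 where w1: "\<And>w. w \<ge> w1 \<Longrightarrow>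
      C * (r' * ln w / w) powr q * w powr (q / 2) < exp 1 / 20 * v' \<and> r' * ln w / w < 1 / x0"
    by (auto simp: eventually_at_top_linorder)
  define T where "T = max 2 (max t1 w1)"
  show ?thesis
  proof (rule that[OF \<theta>])
    show "T > 0" by (simp add: T_def)
    fix a w h assume a: "0 < a" "a \<le> 1" and T: "a * w \<ge> T" and aw: "a * w \<ge> c * ln (1 / a)"
      and h: "h = ln (a * w powr (r - 1 + (r - 2) / 20)) / w"
    define t where "t = a * w"
    have t: "t \<ge> 2" "t \<ge> t1" "t \<ge> w1" using T by (auto simp: T_def t_def)
    have w0: "w > 0" using t(1) a unfolding t_def by (metis less_le_trans zero_less_mult_pos zero_less_numeral)
    have wt: "w \<ge> t" unfolding t_def using a w0 by (simp add: mult_left_le_one_le)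
    have lna: "ln (1 / a) \<ge> 0" using a by simp
    have lnw: "ln w = ln t + ln (1 / a)" using a w0 by (simp add: t_def ln_mult ln_div)
    \<comment> \<open>This is \<open>h * w\<close>, expressed through \<open>t = a * w\<close>. The
      factor \<open>a\<close> inside the logarithm of the tilt lowers the coefficient of
      \<open>ln (1 / a)\<close> from \<open>r - 1 + \<eta>\<close> to
      \<open>\<kappa> + \<eta>\<close>.\<close>
    define \<Lambda> where "\<Lambda> = (r - 1 + \<eta>) * ln t + (\<kappa> + \<eta>) * ln (1 / a)"
    have hw: "h = \<Lambda> / w"
    proof -
      have "ln (a * w powr (r - 1 + (r - 2) / 20)) = ln a + (r - 1 + \<eta>) * ln w"
        using a w0 by (simp add: ln_mult ln_powr \<eta>_def \<kappa>_def)
      also have "\<dots> = \<Lambda>" unfolding \<Lambda>_def lnw using a by (simp add: ln_div \<kappa>_def algebra_simps)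
      finally show ?thesis unfolding h by simp
    qed
    have \<Lambda>0: "\<Lambda> > 0"
    proof -
      have "(r - 1 + \<eta>) * ln t > 0" using t r \<kappa> by (intro mult_pos_pos) auto
      moreover have "(\<kappa> + \<eta>) * ln (1 / a) \<ge> 0" using \<kappa> lna by (intro mult_nonneg_nonneg) auto
      ultimately show ?thesis by (simp add: \<Lambda>_def)
    qed
    have h0: "h > 0" using \<Lambda>0 w0 by (simp add: hw)
    have \<Lambda>t: "\<Lambda> \<le> (11 / 10 * \<kappa>) / c * t"
    proof -
      have "ln (1 / a) \<le> t / c" using aw c0 by (simp add: t_def field_simps)
      then have "(\<kappa> + \<eta>) * ln (1 / a) \<le> (\<kappa> + \<eta>) * (t / c)" using \<kappa> by (intro mult_left_mono) auto
      then have "\<Lambda> \<le> \<eta> / c * t + (\<kappa> + \<eta>) * (t / c)" using t1[OF t(2)] by (simp add: \<Lambda>_def)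
      also have "\<dots> = (11 / 10 * \<kappa>) / c * t" by (simp add: \<eta>_def field_simps)
      finally show ?thesis .
    qed
    \<comment> \<open>Two factors \<open>11 / 10\<close>, one from \<open>\<Lambda>t\<close> and one
      as margin for the tail term, against the \<open>5 / 4\<close> in \<open>c'\<close>: their
      quotient is \<open>121 / 125 < 1\<close>.\<close>
    have ha: "11 / 10 * exp 1 * v' * h \<le> a"
    proof -
      have "11 / 10 * exp 1 * v' * \<Lambda> \<le> 11 / 10 * exp 1 * v' * ((11 / 10 * \<kappa>) / c * t)"
        using v' by (intro mult_left_mono \<Lambda>t) auto
      also have "\<dots> = 121 / 125 * ((5 / 4 * exp 1 * \<kappa> * v') / c) * t" by (simp add: field_simps)
      also have "\<dots> \<le> 1 * 1 * t"
        using c' c0 t \<kappa> v' by (intro mult_mono) auto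
      finally show ?thesis using w0 by (simp add: hw t_def field_simps)
    qed
    have \<Lambda>w: "\<Lambda> \<le> r' * ln w"
    proof -
      have "\<Lambda> \<le> r' * ln t + r' * ln (1 / a)"
        unfolding \<Lambda>_def r'_def using t lna \<kappa> r
        by (intro add_mono mult_right_mono) (auto simp: \<kappa>_def)
      then show ?thesis by (simp add: lnw algebra_simps)
    qed
    have ww: "C * (r' * ln w / w) powr q * w powr (q / 2) < exp 1 / 20 * v'" "r' * ln w / w < 1 / x0"
      using w1[of w] wt t by auto
    have hle: "h \<le> r' * ln w / w" using \<Lambda>w w0 by (simp add: hw divide_right_mono)
    have V: "V (1 / h) \<le> C * (h\<^sup>2 * h powr q)"
    proof -
      have "h < 1 / x0" using hle ww by simp
      then have "1 / h \<ge> x0" using h0 C by (simp add: field_simps)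
      then have "V (1 / h) \<le> C * (1 / h) powr - (2 + q)" by (rule C)
      also have "(1 / h) powr - (2 + q) = h powr (2 + q)" using h0 by (simp add: powr_def ln_div algebra_simps)
      also have "\<dots> = h\<^sup>2 * h powr q" using h0 by (simp add: powr_add)
      finally show ?thesis .
    qed
    have "exp (h * (4 * \<theta> * w)) = exp (4 * \<theta> * \<Lambda>)" using w0 by (simp add: hw)
    also have "\<dots> \<le> exp (4 * \<theta> * (r' * ln w))"
      unfolding exp_le_cancel_iff using \<theta> by (intro mult_left_mono \<Lambda>w) auto
    also have "\<dots> = w powr (q / 2)" using w0 r' by (simp add: powr_def \<theta>_def)
    finally have E: "exp (h * (4 * \<theta> * w)) \<le> w powr (q / 2)" .
    have "exp (h * (4 * \<theta> * w)) * V (1 / h) \<le> w powr (q / 2) * (C * (h\<^sup>2 * h powr q))"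
      using V E pos[of "1 / h"] by (intro mult_mono) auto
    also have "\<dots> \<le> w powr (q / 2) * (C * (h\<^sup>2 * (r' * ln w / w) powr q))"
      using hle h0 q C by (intro mult_left_mono powr_mono2) auto
    also have "\<dots> = (C * (r' * ln w / w) powr q * w powr (q / 2)) * h\<^sup>2" by (simp add: mult_ac)
    also have "\<dots> \<le> (exp 1 / 20 * v') * h\<^sup>2" using ww by (intro mult_right_mono) auto
    finally have 1: "exp (h * (4 * \<theta> * w)) * V (1 / h) \<le> (exp 1 / 20 * v') * h\<^sup>2" .
    have 2: "exp 1 / 2 * h\<^sup>2 * v \<le> exp 1 / 2 * h\<^sup>2 * v'" using v' by (intro mult_left_mono) auto
    \<comment> \<open>The coefficients add up as \<open>1 / 2 + 1 / 20 = 11 / 20\<close>, half of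
      the factor in \<open>ha\<close>.\<close>
    have "1 + exp 1 / 2 * h\<^sup>2 * v + exp (h * (4 * \<theta> * w)) * V (1 / h) \<le> 1 + (11 / 10 * exp 1 * v' * h) * h / 2"
      using 1 2 by (simp add: power2_eq_square algebra_simps)
    also have "\<dots> \<le> 1 + h * (a / 2)"
      using mult_right_mono[OF ha, of "h / 2"] h0 by (simp add: algebra_simps)
    also have "\<dots> \<le> exp (h * (a / 2))" by (rule exp_ge_add_one_self)
    finally show "h > 0 \<and> 1 + exp 1 / 2 * h\<^sup>2 * v + exp (h * (4 * \<theta> * w)) * V (1 / h) \<le> exp (h * (a / 2))"
      using h0 by simp
  qed
qed

end

section \<open>Walks with regularly varying tail\<close>

locale regularly_varying_walk = centred_walk M \<xi> V v + regularly_varying_tail V r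
  for M :: "'a measure" and \<xi> V v r
begin

abbreviation exceeds :: "real \<Rightarrow> real \<Rightarrow> 'a set" where
  "exceeds a x \<equiv> {\<omega>\<in>space M. \<exists>k. random_walk \<xi> k \<omega> > x + a * real k}"

text \<open>One factor \<open>1 + \<delta>\<close> is the margin in the jump size; the other absorbs
  the first cell of the Riemann sum, as \<open>a \<le> \<delta> * x\<close>. By \<open>small\<close>
  the last factor is not cut off by \<open>ennreal\<close>.\<close>

lemma exceeds_lower:
  assumes "a > 0" "x > 0" "0 < \<delta>" "\<delta> \<le> 1" "a \<le> \<delta> * x" and small: "v / (\<delta>\<^sup>2 * a * x) \<le> 1"
    and J: "(\<integral>\<^sup>+u. ennreal (V u) * indicator {(1 + \<delta>)\<^sup>2 * x..} u \<partial>lborel) = ennreal (tail_integral ((1 + \<delta>)\<^sup>2 * x))"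
  shows "tail_integral ((1 + \<delta>)\<^sup>2 * x) / ((1 + \<delta>) * a) * (1 - v / (\<delta>\<^sup>2 * a * x)) \<le> prob (exceeds a x)"
proof -
  have "(1 + \<delta>) * x + (1 + \<delta>) * a = (1 + \<delta>) * (x + a)" by (simp add: algebra_simps)
  also have "\<dots> \<le> (1 + \<delta>) * ((1 + \<delta>) * x)"
    using assms by (intro mult_left_mono) (auto simp: algebra_simps)
  finally have le: "(1 + \<delta>) * x + (1 + \<delta>) * a \<le> (1 + \<delta>)\<^sup>2 * x" by (simp add: power2_eq_square mult.assoc)
  have "ennreal (tail_integral ((1 + \<delta>)\<^sup>2 * x) / ((1 + \<delta>) * a)) \<le> (\<Sum>n. ennreal (V ((1 + \<delta>) * x + (1 + \<delta>) * a * real (Suc n))))"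
    by (rule integral_le_tail_sum[OF _ le J]) (use assms in auto)
  also have "(\<lambda>n. (1 + \<delta>) * x + (1 + \<delta>) * a * real (Suc n)) = (\<lambda>n. (1 + \<delta>) * (x + a * real (Suc n)))"
    by (simp add: fun_eq_iff algebra_simps)
  finally have "ennreal (tail_integral ((1 + \<delta>)\<^sup>2 * x) / ((1 + \<delta>) * a)) * ennreal (1 - v / (\<delta>\<^sup>2 * a * x))
     \<le> (\<Sum>n. ennreal (V ((1 + \<delta>) * (x + a * real (Suc n))))) * ennreal (1 - v / (\<delta>\<^sup>2 * a * x))"
    by (auto intro!: mult_right_mono dest: fun_cong)
  also have "\<dots> \<le> emeasure M (exceeds a x)"
    by (rule walk_exceeds_lower) (use assms in auto)
  finally show ?thesis
    using small by (subst (asm) ennreal_mult''[symmetric]) (auto simp: emeasure_eq_measure)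
qed

text \<open>The choice of \<open>h\<close> makes the contribution of height \<open>w\<close> exactly
  \<open>1 / (a * w powr p)\<close>. As \<open>w j \<ge> 2 ^ j * x / 2\<close> and
  \<open>p \<ge> 1\<close>, the levels are dominated by a geometric series of ratio
  \<open>1 / 2\<close>.\<close>

lemma exceeds_upper:
  assumes "a > 0" "x > 0" "0 < \<delta>" "\<delta> < 1" "0 < \<theta>" "p \<ge> 1"
    and h: "\<And>w. h w = ln (a * w powr p) / w"
    and tilt: "\<And>w. w \<ge> x \<Longrightarrow> h w > 0 \<and>
        1 + exp 1 / 2 * (h w)\<^sup>2 * v + exp (h w * (4 * \<theta> * w)) * V (1 / h w) \<le> exp (h w * (a / 2))"
    and J1: "(\<integral>\<^sup>+u. ennreal (V u) * indicator {(1 - \<delta>) * x..} u \<partial>lborel) = ennreal (tail_integral ((1 - \<delta>) * x))"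
    and J2: "(\<integral>\<^sup>+u. ennreal (V u) * indicator {\<theta> * x..} u \<partial>lborel) = ennreal (tail_integral (\<theta> * x))"
  shows "prob (exceeds a x) \<le> tail_integral ((1 - \<delta>) * x) / ((1 - \<delta>) * a) + tail_integral (\<theta> * x) / (\<theta> * a) * (v / (\<delta>\<^sup>2 * a * x))
     + 2 powr (p + 1) / (a * x powr p)"
proof -
  define w where "w j = (1 + 2 ^ j) * x / 2" for j :: nat
  have wx: "w j \<ge> x" for j
  proof -
    have "1 * x \<le> 2 ^ j * x" using assms by (intro mult_right_mono) auto
    then show ?thesis by (simp add: w_def algebra_simps)
  qed
  have scale: "(\<lambda>n. l * x + l * a * real (Suc n)) = (\<lambda>n. l * (x + a * real (Suc n)))" for l :: real
    by (simp add: fun_eq_iff algebra_simps)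
  have sum: "(\<Sum>n. ennreal (V (l * (x + a * real (Suc n))))) \<le> ennreal (tail_integral (l * x) / (l * a))"
    if "l > 0" "(\<integral>\<^sup>+u. ennreal (V u) * indicator {l * x..} u \<partial>lborel) = ennreal (tail_integral (l * x))" for l
    using tail_sum_le_integral[OF _ that(2), of "l * a"] that(1) assms unfolding fun_cong[OF scale] by auto
  have J0: "tail_integral y \<ge> 0" for y unfolding tail_integral_def by (rule Bochner_Integration.integral_nonneg) (simp add: pos less_imp_le)
  have hw: "exp (- (h (w j) * w j)) \<le> (1 / 2) ^ j * (2 powr p / (a * x powr p))" for j
  proof -
    have wj: "w j > 0" using wx[of j] assms by simp
    have "exp (- (h (w j) * w j)) = 1 / (a * w j powr p)"
      using wj assms by (simp add: h exp_minus inverse_eq_divide)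
    also have "\<dots> \<le> 1 / (a * (2 ^ j * (x / 2) powr p))"
    proof -
      have "2 ^ j * (x / 2) powr p \<le> (2 ^ j) powr p * (x / 2) powr p"
      proof (rule mult_right_mono)
        show "2 ^ j \<le> ((2::real) ^ j) powr p"
          using powr_mono[of 1 p "2 ^ j"] assms by simp
      qed simp
      also have "\<dots> = (2 ^ j * (x / 2)) powr p" using assms(2) by (subst powr_mult) auto
      also have "\<dots> \<le> w j powr p" using assms by (intro powr_mono2) (auto simp: w_def algebra_simps)
      finally show ?thesis using assms wj
        by (intro divide_left_mono mult_left_mono mult_pos_pos) auto
    qed
    also have "\<dots> = (1 / 2) ^ j * (2 powr p / (a * x powr p))"
      using assms by (simp add: powr_divide power_divide field_simps)
    finally show ?thesis .
  qed
  have sumC: "(\<Sum>j. ennreal (exp (- (h (w j) * w j)))) \<le> ennreal (2 powr (p + 1) / (a * x powr p))"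
  proof -
    have "(\<Sum>j. ennreal (exp (- (h (w j) * w j)))) \<le> (\<Sum>j. ennreal ((1 / 2) ^ j * (2 powr p / (a * x powr p))))"
      by (intro suminf_le summableI ennreal_leI hw)
    also have "\<dots> = ennreal (2 * (2 powr p / (a * x powr p)))"
    proof (rule suminf_ennreal_eq)
      show "(\<lambda>j. (1 / 2) ^ j * (2 powr p / (a * x powr p))) sums (2 * (2 powr p / (a * x powr p)))"
        using sums_mult2[OF geometric_sums[of "1 / 2 :: real"], of "2 powr p / (a * x powr p)"] by simp
    qed (use assms in auto)
    finally show ?thesis by (simp add: powr_add mult.commute)
  qed
  have "emeasure M (exceeds a x) \<le>
     (\<Sum>n. ennreal (V ((1 - \<delta>) * (x + a * real (Suc n))))) +
     (\<Sum>n. ennreal (V (\<theta> * (x + a * real (Suc n))))) * ennreal (v / (\<delta>\<^sup>2 * a * x)) +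
     (\<Sum>j. ennreal (exp (- (h (w j) * w j))))"
  proof (rule walk_exceeds_upper[OF assms(1-5)])
    show "h (w j) > 0" for j using tilt[OF wx] by simp
    show "(\<integral>\<^sup>+\<omega>. ennreal (exp (h (w j) * min (\<xi> n \<omega>) (4 * \<theta> * w j))) \<partial>M) \<le> ennreal (exp (h (w j) * (a / 2)))" for j n
    proof (rule order_trans[OF exp_min_le])
      show "4 * \<theta> * w j > 0" using wx[of j] assms by simp
    qed (use tilt[OF wx] in \<open>auto intro: ennreal_leI\<close>)
  qed (simp add: w_def)
  also have "\<dots> \<le> ennreal (tail_integral ((1 - \<delta>) * x) / ((1 - \<delta>) * a)) + ennreal (tail_integral (\<theta> * x) / (\<theta> * a)) * ennreal (v / (\<delta>\<^sup>2 * a * x))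
     + ennreal (2 powr (p + 1) / (a * x powr p))"
    using assms by (intro add_mono mult_right_mono sum sumC) auto
  also have "\<dots> = ennreal (tail_integral ((1 - \<delta>) * x) / ((1 - \<delta>) * a) + tail_integral (\<theta> * x) / (\<theta> * a) * (v / (\<delta>\<^sup>2 * a * x))
     + 2 powr (p + 1) / (a * x powr p))"
  proof -
    have "ennreal A + ennreal B * ennreal C + ennreal D = ennreal (A + B * C + D)"
      if "A \<ge> 0" "B \<ge> 0" "C \<ge> 0" "D \<ge> 0" for A B C D
      using that by (simp add: ennreal_mult)
    then show ?thesis using assms(1-6) J0 v_nonneg by simp
  qed
  finally show ?thesis
    unfolding emeasure_eq_measure
    by (subst (asm) ennreal_le_iff) (use assms(1-6) J0 v_nonneg in simp)
qed

end

section \<open>Limits of the main terms and of the negligible ones\<close>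

context regularly_varying_tail
begin

lemma karamata_scaled:
  assumes r: "r > 1" and l: "l > 0"
  shows "((\<lambda>y. tail_integral (l * y) / (y * V y)) \<longlongrightarrow> l powr (1 - r) / (r - 1)) at_top"
proof -
  have ltop: "filterlim (\<lambda>y. l * y) at_top at_top" using l by real_asymp
  have "((\<lambda>y. tail_integral (l * y) / (l * y * V (l * y)) * (l * (V (l * y) / V y))) \<longlongrightarrow> 1 / (r - 1) * (l * l powr - r)) at_top"
    by (intro tendsto_mult tendsto_const rv l filterlim_compose[OF karamata(1)[OF r] ltop])
  moreover have "l * l powr - r = l powr (1 - r)" using l by (simp add: powr_diff powr_minus field_simps)
  moreover have "eventually (\<lambda>y. tail_integral (l * y) / (l * y * V (l * y)) * (l * (V (l * y) / V y)) = tail_integral (l * y) / (y * V y)) at_top"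
    using eventually_gt_at_top[of 0]
  proof eventually_elim
    case (elim y)
    then show ?case using l pos[of y] pos[of "l * y"] by (simp add: field_simps)
  qed
  ultimately show ?thesis by (auto intro: Lim_transform_eventually)
qed

text \<open>A Potter lower bound with exponent midway between \<open>r\<close> and
  \<open>\<rho>\<close> leaves a positive power to spare. It shows that paths without a sizable jump
  are negligible.\<close>

lemma power_dominates_V:
  assumes "0 < r" "r < \<rho>"
  shows "((\<lambda>y. 1 / (y powr \<rho> * V y)) \<longlongrightarrow> 0) at_top"
proof -
  define q where "q = (\<rho> - r) / 2"
  have q: "q > 0" "r < \<rho> - q" "0 < \<rho> - q" using assms by (auto simp: q_def field_simps)
  obtain c x0 where c: "c > 0" "x0 > 0" "\<And>u. u \<ge> x0 \<Longrightarrow> V u \<ge> c * u powr - (\<rho> - q)"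
    by (rule V_lower[OF q(3) q(2)]) blast
  have "((\<lambda>y. 1 / (c * y powr q)) \<longlongrightarrow> 0) at_top" using c q by real_asymp
  moreover have "eventually (\<lambda>y. 1 / (y powr \<rho> * V y) \<le> 1 / (c * y powr q)) at_top"
    using eventually_ge_at_top[of x0]
  proof eventually_elim
    case (elim y)
    then have y: "y > 0" using c by simp
    have "c * y powr q = y powr \<rho> * (c * y powr - (\<rho> - q))"
      using y by (simp add: powr_minus powr_diff field_simps)
    also have "\<dots> \<le> y powr \<rho> * V y" using c(3)[OF elim] by (intro mult_left_mono) auto
    finally show ?case using c y pos[of y] by (intro divide_left_mono mult_pos_pos) auto
  qed
  moreover have "eventually (\<lambda>y. 0 \<le> 1 / (y powr \<rho> * V y)) at_top"
    using pos by (intro always_eventually) (simp add: less_imp_le)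
  ultimately show ?thesis by (rule_tac tendsto_sandwich[OF _ _ tendsto_const])
qed

end

section \<open>From the hypotheses on \<open>X\<close>, \<open>L\<close> and the walks to the
  locales\<close>

lemma (in prob_space) regularly_varying_tailI:
  assumes [measurable]: "random_variable borel X"
    and L: "slowly_varying L" and tail: "\<And>u. u > 0 \<Longrightarrow> prob {\<omega>\<in>space M. X \<omega> > u} = u powr - r * L u"
  shows "regularly_varying_tail (\<lambda>u. prob {\<omega>\<in>space M. X \<omega> > u}) r"
proof
  let ?V = "\<lambda>u. prob {\<omega>\<in>space M. X \<omega> > u}"
  show anti: "antimono ?V"
    by (intro antimonoI finite_measure_mono) auto
  obtain A where A: "\<And>u. u \<ge> A \<Longrightarrow> 0 < L u" using L by (auto simp: slowly_varying_def)
  show "0 < ?V u" for u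
  proof -
    have "0 < ?V (max u (max A 1))" using A by (subst tail) auto
    \<comment> \<open>\<open>L\<close> is known to be positive only from \<open>A\<close> on;
      monotonicity carries positivity of the tail to all arguments.\<close>
    also have "\<dots> \<le> ?V u" by (rule antimonoD[OF anti]) simp
    finally show ?thesis .
  qed
  show "((\<lambda>u. ?V (c * u) / ?V u) \<longlongrightarrow> c powr - r) at_top" if c: "c > 0" for c
  proof -
    have "((\<lambda>u. c powr - r * (L (c * u) / L u)) \<longlongrightarrow> c powr - r * 1) at_top"
      using L c by (intro tendsto_mult tendsto_const) (auto simp: slowly_varying_def)
    moreover have "eventually (\<lambda>u. c powr - r * (L (c * u) / L u) = ?V (c * u) / ?V u) at_top"
      using eventually_gt_at_top[of 0]
    proof eventually_elim
      case (elim u)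
      then show ?case using c by (simp add: tail powr_mult)
    qed
    ultimately show ?thesis by (auto intro: Lim_transform_eventually)
  qed
qed

text \<open>Adding \<open>a\<close> back gives the increments the law of \<open>X\<close>, on which
  moments and tail depend; hence \<open>V\<close> and \<open>v\<close> are the same for all
  \<open>a\<close>.\<close>

lemma centred_walk_of_copies:
  assumes \<Omega>: "prob_space \<Omega>" and X[measurable]: "X \<in> borel_measurable \<Omega>"
    and int: "integrable \<Omega> X" "integrable \<Omega> (\<lambda>\<omega>. (X \<omega>)\<^sup>2)" and mean: "prob_space.expectation \<Omega> X = 0"
    and P: "prob_space P" and Y: "indep_copies P Y \<Omega> (\<lambda>\<omega>. X \<omega> - a)"
  shows "centred_walk P (\<lambda>n \<omega>. Y n \<omega> + a) (\<lambda>u. measure \<Omega> {\<omega>\<in>space \<Omega>. X \<omega> > u}) (prob_space.variance \<Omega> X)"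
proof -
  interpret P: prob_space P by fact
  let ?\<xi> = "\<lambda>n \<omega>. Y n \<omega> + a"
  have ind: "P.indep_vars (\<lambda>_. borel) Y UNIV" and dY: "distr P borel (Y n) = distr \<Omega> borel (\<lambda>\<omega>. X \<omega> - a)" for n
    using Y by (auto simp: indep_copies_def)
  have Ym[measurable]: "Y n \<in> borel_measurable P" for n using ind by (auto simp: P.indep_vars_def)
  have d: "distr P borel (?\<xi> n) = distr \<Omega> borel X" for n
  proof -
    have "distr P borel (?\<xi> n) = distr (distr P borel (Y n)) borel (\<lambda>y. y + a)"
      by (subst distr_distr) (auto simp: comp_def)
    also have "\<dots> = distr \<Omega> borel X"
      unfolding dY by (subst distr_distr) (auto simp: comp_def)
    finally show ?thesis .
  qed
  have ex: "P.expectation (\<lambda>\<omega>. f (?\<xi> n \<omega>)) = (\<integral>\<omega>. f (X \<omega>) \<partial>\<Omega>)"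
    if [measurable]: "f \<in> borel_measurable borel" for f :: "real \<Rightarrow> real" and n
    using integral_distr[of "?\<xi> n" P borel f] integral_distr[of X \<Omega> borel f] d[of n] by simp
  have it: "integrable P (\<lambda>\<omega>. f (?\<xi> n \<omega>)) \<longleftrightarrow> integrable \<Omega> (\<lambda>\<omega>. f (X \<omega>))"
    if [measurable]: "f \<in> borel_measurable borel" for f :: "real \<Rightarrow> real" and n
    using integrable_distr_eq[of "?\<xi> n" P borel f] integrable_distr_eq[of X \<Omega> borel f] d[of n] by simp
  show ?thesis
  proof
    show "P.indep_vars (\<lambda>_. borel) ?\<xi> UNIV"
      by (rule P.indep_vars_compose2[OF ind]) auto
    show "integrable P (?\<xi> n)" "integrable P (\<lambda>\<omega>. (?\<xi> n \<omega>)\<^sup>2)" for n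
      using it[of "\<lambda>y. y" n] it[of "\<lambda>y. y\<^sup>2" n] int by auto
    show "P.expectation (?\<xi> n) = 0" "P.expectation (\<lambda>\<omega>. (?\<xi> n \<omega>)\<^sup>2) = prob_space.variance \<Omega> X" for n
      using ex[of "\<lambda>y. y" n] ex[of "\<lambda>y. y\<^sup>2" n] mean by auto
    show "P.prob {\<omega>\<in>space P. ?\<xi> n \<omega> > u} = measure \<Omega> {\<omega>\<in>space \<Omega>. X \<omega> > u}" for n u
    proof -
      have "measure (distr P borel (?\<xi> n)) {u<..} = measure (distr \<Omega> borel X) {u<..}" unfolding d ..
      then show ?thesis by (simp add: measure_distr vimage_def Int_def conj_commute)
    qed
  qed
qed

text \<open>As the inequality is strict, it does not matter whether the supremum is
  attained.\<close>

lemma less_walk_max_iff: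
  "ereal y < walk_max Y \<omega> \<longleftrightarrow> (\<exists>k. random_walk (\<lambda>n \<omega>. Y n \<omega> + a) k \<omega> > y + a * real k)"
  by (simp add: walk_max_def less_SUP_iff random_walk_def sum.distrib mult.commute)

theorem theorem9:
  fixes \<Omega> :: "'a measure" and X :: "'a \<Rightarrow> real"
    and P :: "real \<Rightarrow> 'b measure" and Y :: "real \<Rightarrow> nat \<Rightarrow> 'b \<Rightarrow> real"
    and x :: "real \<Rightarrow> real" and L :: "real \<Rightarrow> real" and r :: real
  assumes "prob_space \<Omega>"
    and "X \<in> borel_measurable \<Omega>"
    and "integrable \<Omega> X"
    and "prob_space.expectation \<Omega> X = 0"
    and "integrable \<Omega> (\<lambda>\<omega>. (X \<omega>)\<^sup>2)"
    and "r > 2"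
    and "slowly_varying L"
    and "\<And>u. u > 0 \<Longrightarrow> measure \<Omega> {\<omega> \<in> space \<Omega>. X \<omega> > u} = u powr (- r) * L u"
    and "\<And>a. a > 0 \<Longrightarrow> prob_space (P a)"
    and "\<And>a. a > 0 \<Longrightarrow> indep_copies (P a) (Y a) \<Omega> (\<lambda>\<omega>. X \<omega> - a)"
    and "\<And>a. a > 0 \<Longrightarrow> x a > 0"
    and "Liminf (at_right 0) (\<lambda>a. ereal (x a / ((1 / a) * ln (1 / a))))
           > ereal (exp r * ((r - 2) / 2) * prob_space.variance \<Omega> X)"
  shows "(\<lambda>a. measure (P a) {\<omega> \<in> space (P a). walk_max (Y a) \<omega> > ereal (x a)})
           \<sim>[at_right 0] (\<lambda>a. x a powr (- r + 1) * L (x a) / ((r - 1) * a))"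
proof -
  interpret \<Omega>: prob_space \<Omega> by fact
  define V where "V u = measure \<Omega> {\<omega> \<in> space \<Omega>. X \<omega> > u}" for u
  define v where "v = \<Omega>.variance X"
  have v: "v \<ge> 0" unfolding v_def by (rule Bochner_Integration.integral_nonneg) simp
  have r: "r > 2" "r > 1" "r > 0" using assms(6) by auto
  interpret regularly_varying_tail V r
    unfolding V_def by (rule \<Omega>.regularly_varying_tailI[OF assms(2,7,8)])
  have walk: "regularly_varying_walk (P a) (\<lambda>n \<omega>. Y a n \<omega> + a) V v r" if "a > 0" for a
    using centred_walk_of_copies[OF assms(1-3) assms(5,4) assms(9,10)[OF that]] regularly_varying_tail_axioms
    unfolding regularly_varying_walk_def V_def v_def by simp
  define p where "p a = measure (P a) {\<omega> \<in> space (P a). walk_max (Y a) \<omega> > ereal (x a)}" for a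
  define R where "R a = x a * V (x a) / ((r - 1) * a)" for a
  have R: "x a powr (- r + 1) * L (x a) / ((r - 1) * a) = R a" if "a > 0" for a
    using assms(8)[of "x a"] assms(11)[OF that] unfolding powr_add by (simp add: R_def V_def mult_ac)
  have Rpos: "R a > 0" if "a > 0" for a
    using assms(11)[OF that] pos r that by (simp add: R_def)

  \<comment> \<open>The constant \<open>c\<close> and the growth of \<open>x\<close>\<close>
  obtain c where c: "exp r * ((r - 2) / 2) * v < c"
    and Lc: "ereal c < Liminf (at_right 0) (\<lambda>a. ereal (x a / ((1 / a) * ln (1 / a))))"
    using ereal_dense2[OF assms(12)] by (auto simp: v_def)
  have c54: "5 / 4 * exp 1 * (r - 2) * v < c"
  proof -
    \<comment> \<open>Splitting \<open>exp r\<close> as \<open>exp (r - 1) * exp 1\<close> with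
      \<open>r - 1 \<ge> 1\<close> gives \<open>exp r / 2 \<ge> 5 / 4 * exp 1\<close>, the constant
      required by \<open>exponential_tilt\<close>.\<close>
    have "5 / 2 \<le> exp (1::real)" using exp_lower_Taylor_quadratic[of 1] by simp
    also have "\<dots> \<le> exp (r - 1)" using r by simp
    finally have "5 / 2 * exp 1 \<le> exp (r - 1) * exp 1" by simp
    also have "\<dots> = exp r" by (simp add: exp_add[symmetric])
    finally have "5 / 2 * exp 1 * ((r - 2) / 2 * v) \<le> exp r * ((r - 2) / 2 * v)"
      using r v by (intro mult_right_mono) auto
    moreover have "5 / 4 * exp 1 * (r - 2) * v = 5 / 2 * exp 1 * ((r - 2) / 2 * v)"
      and "exp r * ((r - 2) / 2) * v = exp r * ((r - 2) / 2 * v)" by (simp_all add: field_simps)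
    ultimately show ?thesis using c by linarith
  qed
  have c0: "c > 0" using c v r by (rule_tac le_less_trans[OF _ c]) auto
  have small: "eventually (\<lambda>a. 0 < a \<and> a < 1) (at_right (0::real))"
    by (auto intro: eventually_at_rightI[of 0 1])
  have ax: "eventually (\<lambda>a. c * ln (1 / a) \<le> a * x a) (at_right 0)"
    using less_LiminfD[OF Lc] small
  proof eventually_elim
    case (elim a)
    then have "ln (1 / a) > 0" by simp
    then show ?case using elim by (simp add: field_simps)
  qed
  \<comment> \<open>As \<open>c > 0\<close>, the logarithm drives \<open>a * x a\<close> to
    infinity, and the cone-exit errors \<open>v / (\<delta>\<^sup>2 * a * x a)\<close>
    vanish.\<close>
  have axtop: "filterlim (\<lambda>a. a * x a) at_top (at_right 0)"
  proof (rule filterlim_at_top_mono[OF _ ax])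
    show "filterlim (\<lambda>a. c * ln (1 / a)) at_top (at_right 0)" using c0 by real_asymp
  qed
  have xtop: "filterlim x at_top (at_right 0)"
  proof (rule filterlim_at_top_mono[OF axtop])
    show "\<forall>\<^sub>F a in at_right 0. a * x a \<le> x a"
      using small
    proof eventually_elim
      case (elim a)
      then show ?case using assms(11)[of a] by simp
    qed
  qed
  obtain \<theta> T where \<theta>: "\<theta> > 0" and "T > 0" and tilt:
    "\<And>a w h. 0 < a \<Longrightarrow> a \<le> 1 \<Longrightarrow> a * w \<ge> T \<Longrightarrow> a * w \<ge> c * ln (1 / a) \<Longrightarrow>
       h = ln (a * w powr (r - 1 + (r - 2) / 20)) / w \<Longrightarrow>
       h > 0 \<and> 1 + exp 1 / 2 * h\<^sup>2 * v + exp (h * (4 * \<theta> * w)) * V (1 / h) \<le> exp (h * (a / 2))"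
    by (rule exponential_tilt[OF r(1) v c54]) blast
  \<comment> \<open>The exponent in the tilt. Since \<open>q + 1 > r\<close>, the term
    \<open>1 / (a * x a powr q)\<close> is negligible against \<open>R a\<close>.\<close>
  define q where "q = r - 1 + (r - 2) / 20"
  have q: "q \<ge> 1" "r < q + 1" using r by (simp_all add: q_def field_simps)
  have Jx: "((\<lambda>a. tail_integral (l * x a) / (x a * V (x a))) \<longlongrightarrow> l powr (1 - r) / (r - 1)) (at_right 0)" if "l > 0" for l
    by (rule filterlim_compose[OF karamata_scaled[OF r(2) that] xtop])
  have Jn: "\<forall>\<^sub>F a in at_right 0. (\<integral>\<^sup>+u. ennreal (V u) * indicator {l * x a..} u \<partial>lborel) = ennreal (tail_integral (l * x a))"
    if "l > 0" for l
  proof -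
    have "filterlim (\<lambda>a. l * x a) at_top (at_right 0)"
      using xtop that by (rule_tac filterlim_tendsto_pos_mult_at_top[OF tendsto_const])
    then show ?thesis using karamata(2)[OF r(2)] unfolding filterlim_iff by blast
  qed
  have inv: "((\<lambda>a. k / (a * x a)) \<longlongrightarrow> 0) (at_right 0)" for k :: real
    by (rule tendsto_divide_0[OF tendsto_const filterlim_at_top_imp_at_infinity[OF axtop]])

  \<comment> \<open>Upper bound for fixed \<open>\<delta>\<close>, and its limit\<close>
  have upper: "\<forall>\<^sub>F a in at_right 0. p a / R a \<le> (r - 1) * (tail_integral ((1 - \<delta>) * x a) / (x a * V (x a)) / (1 - \<delta>)
      + tail_integral (\<theta> * x a) / (x a * V (x a)) / \<theta> * ((v / \<delta>\<^sup>2) / (a * x a))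
      + 2 powr (q + 1) * (1 / (x a powr (q + 1) * V (x a))))"
    if \<delta>: "0 < \<delta>" "\<delta> < 1" for \<delta>
    using small ax Jn[OF diff_gt_0_iff_gt[THEN iffD2, OF \<delta>(2)]] Jn[OF \<theta>] filterlim_at_top[THEN iffD1, OF axtop, rule_format, of T]
  proof (eventually_elim)
    case (elim a)
    then have a: "a > 0" "a \<le> 1" by auto
    interpret regularly_varying_walk "P a" "\<lambda>n \<omega>. Y a n \<omega> + a" V v r by (rule walk[OF a(1)])
    have x: "x a > 0" by (rule assms(11)[OF a(1)])
    have "p a \<le> tail_integral ((1 - \<delta>) * x a) / ((1 - \<delta>) * a) + tail_integral (\<theta> * x a) / (\<theta> * a) * (v / (\<delta>\<^sup>2 * a * x a))
     + 2 powr (q + 1) / (a * x a powr q)"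
      unfolding p_def less_walk_max_iff[where a=a]
    proof (rule exceeds_upper[OF a(1) x \<delta> \<theta> q(1)])
      \<comment> \<open>The conditions on the tilt are lower bounds on \<open>a * w\<close>, so they
        pass from \<open>x a\<close> to all higher levels.\<close>
      fix w assume "x a \<le> w"
      then have "a * x a \<le> a * w" using a by simp
      note aw = order_trans[OF _ this]
      show "ln (a * w powr q) / w > 0 \<and>
          1 + exp 1 / 2 * (ln (a * w powr q) / w)\<^sup>2 * v + exp (ln (a * w powr q) / w * (4 * \<theta> * w)) * V (1 / (ln (a * w powr q) / w))
          \<le> exp (ln (a * w powr q) / w * (a / 2))"
        by (intro tilt[OF a] aw) (use elim in \<open>simp_all add: q_def\<close>)
    qed (use elim in auto)
    then have "p a / R a \<le> (tail_integral ((1 - \<delta>) * x a) / ((1 - \<delta>) * a) + tail_integral (\<theta> * x a) / (\<theta> * a) * (v / (\<delta>\<^sup>2 * a * x a))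
     + 2 powr (q + 1) / (a * x a powr q)) / R a"
      by (rule divide_right_mono) (use Rpos[OF a(1)] in simp)
    also have "\<dots> = (r - 1) * (tail_integral ((1 - \<delta>) * x a) / (x a * V (x a)) / (1 - \<delta>)
      + tail_integral (\<theta> * x a) / (x a * V (x a)) / \<theta> * ((v / \<delta>\<^sup>2) / (a * x a))
      + 2 powr (q + 1) * (1 / (x a powr (q + 1) * V (x a))))"
    proof -
      have "x a powr (q + 1) = x a powr q * x a" using x by (simp add: powr_add)
      moreover have "(j1 / (D * a) + j2 / (\<theta> * a) * (v / (d * a * X)) + K / (a * Z)) / (X * W / (s * a)) =
          s * (j1 / (X * W) / D + j2 / (X * W) / \<theta> * ((v / d) / (a * X)) + K * (1 / (Z * X * W)))"
        if "D \<noteq> 0" "X \<noteq> 0" "W \<noteq> 0" for j1 j2 D d X Z W s K :: real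
        using that a(1) by (simp add: add_divide_distrib distrib_left mult_ac)
      ultimately show ?thesis unfolding R_def using x pos[of "x a"] \<delta> by simp
    qed
    finally show ?case .
  qed
  have upper_lim: "((\<lambda>a. (r - 1) * (tail_integral ((1 - \<delta>) * x a) / (x a * V (x a)) / (1 - \<delta>)
      + tail_integral (\<theta> * x a) / (x a * V (x a)) / \<theta> * ((v / \<delta>\<^sup>2) / (a * x a))
      + 2 powr (q + 1) * (1 / (x a powr (q + 1) * V (x a))))) \<longlongrightarrow> (1 - \<delta>) powr - r) (at_right 0)"
    if \<delta>: "0 < \<delta>" "\<delta> < 1" for \<delta>
  proof -
    have "((\<lambda>a. 1 / (x a powr (q + 1) * V (x a))) \<longlongrightarrow> 0) (at_right 0)"
      by (rule filterlim_compose[OF power_dominates_V[OF r(3) q(2)] xtop])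
    then have "((\<lambda>a. (r - 1) * (tail_integral ((1 - \<delta>) * x a) / (x a * V (x a)) / (1 - \<delta>)
      + tail_integral (\<theta> * x a) / (x a * V (x a)) / \<theta> * ((v / \<delta>\<^sup>2) / (a * x a))
      + 2 powr (q + 1) * (1 / (x a powr (q + 1) * V (x a))))) \<longlongrightarrow>
      (r - 1) * ((1 - \<delta>) powr (1 - r) / (r - 1) / (1 - \<delta>) + \<theta> powr (1 - r) / (r - 1) / \<theta> * 0 + 2 powr (q + 1) * 0)) (at_right 0)"
      using \<delta> \<theta> by (intro tendsto_intros Jx inv) auto
    moreover have "(1 - \<delta>) powr (1 - r) / (1 - \<delta>) = (1 - \<delta>) powr - r"
      using \<delta> by (simp add: powr_diff powr_minus field_simps)
    ultimately show ?thesis using r by simp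
  qed

  \<comment> \<open>Lower bound for fixed \<open>\<delta>\<close>, and its limit\<close>
  have lower: "\<forall>\<^sub>F a in at_right 0. p a / R a \<ge> (r - 1) * (tail_integral ((1 + \<delta>)\<^sup>2 * x a) / (x a * V (x a)) / (1 + \<delta>) * (1 - (v / \<delta>\<^sup>2) / (a * x a)))"
    if \<delta>: "0 < \<delta>" "\<delta> < 1" for \<delta>
  proof -
    have "\<forall>\<^sub>F a in at_right 0. (v / \<delta>\<^sup>2) / (a * x a) < 1" by (rule order_tendstoD(2)[OF inv]) simp
    moreover have "\<forall>\<^sub>F a in at_right 0. 1 / \<delta> \<le> x a" using xtop by (auto simp: filterlim_at_top)
    moreover have "(1 + \<delta>)\<^sup>2 > 0" using \<delta> by simp
    note Jn[OF this]
    ultimately show ?thesis using small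
    proof eventually_elim
      case (elim a)
      then have a: "a > 0" "a \<le> 1" by auto
      interpret regularly_varying_walk "P a" "\<lambda>n \<omega>. Y a n \<omega> + a" V v r by (rule walk[OF a(1)])
      have x: "x a > 0" by (rule assms(11)[OF a(1)])
      have "1 \<le> \<delta> * x a" using elim \<delta> by (simp add: field_simps)
      then have "a \<le> \<delta> * x a" using a by simp
      then have "tail_integral ((1 + \<delta>)\<^sup>2 * x a) / ((1 + \<delta>) * a) * (1 - v / (\<delta>\<^sup>2 * a * x a)) \<le> p a"
        unfolding p_def less_walk_max_iff[where a=a]
        using elim \<delta> a x by (intro exceeds_lower) (auto simp: mult.assoc)
      then have "tail_integral ((1 + \<delta>)\<^sup>2 * x a) / ((1 + \<delta>) * a) * (1 - v / (\<delta>\<^sup>2 * a * x a)) / R a \<le> p a / R a"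
        by (rule divide_right_mono) (use Rpos[OF a(1)] in simp)
      also have "tail_integral ((1 + \<delta>)\<^sup>2 * x a) / ((1 + \<delta>) * a) * (1 - v / (\<delta>\<^sup>2 * a * x a)) / R a =
        (r - 1) * (tail_integral ((1 + \<delta>)\<^sup>2 * x a) / (x a * V (x a)) / (1 + \<delta>) * (1 - (v / \<delta>\<^sup>2) / (a * x a)))"
        unfolding R_def using a x pos[of "x a"] r \<delta> by (simp add: mult_ac)
      finally show ?case .
    qed
  qed
  have lower_lim: "((\<lambda>a. (r - 1) * (tail_integral ((1 + \<delta>)\<^sup>2 * x a) / (x a * V (x a)) / (1 + \<delta>) * (1 - (v / \<delta>\<^sup>2) / (a * x a))))
     \<longlongrightarrow> ((1 + \<delta>)\<^sup>2) powr (1 - r) / (1 + \<delta>)) (at_right 0)"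
    if \<delta>: "0 < \<delta>" "\<delta> < 1" for \<delta>
  proof -
    have "((\<lambda>a. (r - 1) * (tail_integral ((1 + \<delta>)\<^sup>2 * x a) / (x a * V (x a)) / (1 + \<delta>) * (1 - (v / \<delta>\<^sup>2) / (a * x a))))
     \<longlongrightarrow> (r - 1) * (((1 + \<delta>)\<^sup>2) powr (1 - r) / (r - 1) / (1 + \<delta>) * (1 - 0))) (at_right 0)"
      using \<delta> by (intro tendsto_intros Jx inv) auto
    then show ?thesis using r by simp
  qed

  \<comment> \<open>Letting \<open>\<delta>\<close> tend to 0: both limits tend to 1, so some
    \<open>\<delta>\<close> puts the relevant one on the right side of \<open>y\<close>\<close>
  have "((\<lambda>a. p a / R a) \<longlongrightarrow> 1) (at_right 0)"
  proof (rule order_tendstoI)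
    fix y :: real assume "y < 1"
    have "((\<lambda>\<delta>::real. ((1 + \<delta>)\<^sup>2) powr (1 - r) / (1 + \<delta>)) \<longlongrightarrow> ((1 + 0)\<^sup>2) powr (1 - r) / (1 + 0)) (at_right 0)"
      by (intro tendsto_intros) auto
    then have "\<forall>\<^sub>F \<delta> in at_right (0::real). y < ((1 + \<delta>)\<^sup>2) powr (1 - r) / (1 + \<delta>)"
      by (rule order_tendstoD) (use \<open>y < 1\<close> in simp)
    with small have "\<forall>\<^sub>F \<delta> in at_right (0::real). (0 < \<delta> \<and> \<delta> < 1) \<and> y < ((1 + \<delta>)\<^sup>2) powr (1 - r) / (1 + \<delta>)"
      by (rule eventually_conj)
    then obtain \<delta> where \<delta>: "0 < \<delta>" "\<delta> < 1" "y < ((1 + \<delta>)\<^sup>2) powr (1 - r) / (1 + \<delta>)"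
      by (auto dest!: eventually_happens)
    show "\<forall>\<^sub>F a in at_right 0. y < p a / R a"
      using lower[OF \<delta>(1,2)] order_tendstoD(1)[OF lower_lim[OF \<delta>(1,2)] \<delta>(3)]
      by eventually_elim linarith
  next
    fix y :: real assume "y > 1"
    have "((\<lambda>\<delta>::real. (1 - \<delta>) powr - r) \<longlongrightarrow> (1 - 0) powr - r) (at_right 0)"
      by (intro tendsto_intros) auto
    then have "\<forall>\<^sub>F \<delta> in at_right (0::real). y > (1 - \<delta>) powr - r"
      by (rule order_tendstoD) (use \<open>y > 1\<close> in simp)
    with small have "\<forall>\<^sub>F \<delta> in at_right (0::real). (0 < \<delta> \<and> \<delta> < 1) \<and> y > (1 - \<delta>) powr - r"
      by (rule eventually_conj)
    then obtain \<delta> where \<delta>: "0 < \<delta>" "\<delta> < 1" "y > (1 - \<delta>) powr - r"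
      by (auto dest!: eventually_happens)
    show "\<forall>\<^sub>F a in at_right 0. p a / R a < y"
      using upper[OF \<delta>(1,2)] order_tendstoD(2)[OF upper_lim[OF \<delta>(1,2)] \<delta>(3)]
      by eventually_elim linarith
  qed
  moreover have "\<forall>\<^sub>F a in at_right 0. p a / R a = p a / (x a powr (- r + 1) * L (x a) / ((r - 1) * a))"
    using small by eventually_elim (simp only: R)
  ultimately show ?thesis
    unfolding p_def[symmetric] by (rule asymp_equivI'[OF Lim_transform_eventually])
qed

end
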